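(* Let $K$ be a Hausdorff compact space belonging to the class $\mathcal{B}$, with weight $\operatorname{w}(K)=\kappa$, and suppose $K$ has a cellular family of cardinality $\gamma$. Then \[\operatorname{Lip}_0(c_0(\gamma))\stackrel{c}{\hookrightarrow}\operatorname{Lip}_0(C(K))\stackrel{c}{\hookrightarrow}\operatorname{Lip}_0(c_0(\kappa)).\]
   Context: $\mathcal{B}$ is the class of all Hausdorff compact spaces $K$ such that $C(K)$ is isomorphic to $C(L)$ for some zero-dimensional Hausdorff compact space $L$. A cellular family in a topological space is a collection of nonempty pairwise disjoint open sets. $\operatorname{w}(K)$ is the weight of $K$ (smallest cardinality of a base). For a metric space $X$ with distinguished point $0$, $\operatorname{Lip}_0(X)$ is the Banach space of real Lipschitz functions vanishing at $0$ with the norm given by the smallest Lipschitz constant; Banach spaces are pointed at $0$. $C(K)$ carries the sup norm. $c_0(\gamma)$ is the space of real families indexed by a set of cardinality $\gamma$ tending to zero (for each $\epsilon>0$ only finitely many coordinates have absolute value $\ge\epsilon$), with sup norm. For Banach spaces $X,Y$, $X\stackrel{c}{\hookrightarrow}Y$ means $Y$ contains a complemented subspace isomorphic to $X$. *)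

theory Defs
  imports "HOL-Analysis.Analysis" "HOL-Library.Equipollence"
begin

definition is_base :: "'a topology \<Rightarrow> 'a set set \<Rightarrow> bool" where
  "is_base K B \<longleftrightarrow> (\<forall>V\<in>B. openin K V) \<and>
     (\<forall>U. openin K U \<longrightarrow> (\<exists>B'. B' \<subseteq> B \<and> \<Union>B' = U))"

definition has_weight :: "'a topology \<Rightarrow> 'k set \<Rightarrow> bool" where
  "has_weight K A \<longleftrightarrow> (\<exists>B. is_base K B \<and> B \<approx> A) \<and> (\<forall>B. is_base K B \<longrightarrow> A \<lesssim> B)"

definition zero_dim :: "'a topology \<Rightarrow> bool" where
  "zero_dim K \<longleftrightarrow> (\<exists>B. is_base K B \<and> (\<forall>V\<in>B. closedin K V))"

definition cellular :: "'a topology \<Rightarrow> 'a set set \<Rightarrow> bool" where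
  "cellular K U \<longleftrightarrow> (\<forall>V\<in>U. openin K V \<and> V \<noteq> {}) \<and>
     (\<forall>V\<in>U. \<forall>W\<in>U. V \<noteq> W \<longrightarrow> V \<inter> W = {})"

text \<open>A (normed) space is represented by a carrier set of real-valued functions on some
type (with pointwise vector operations) together with a norm function.\<close>
type_synonym 'x nspace = "('x \<Rightarrow> real) set \<times> (('x \<Rightarrow> real) \<Rightarrow> real)"

definition c0_space :: "'g set \<Rightarrow> 'g nspace" where
  "c0_space G = ({x. (\<forall>i. i \<notin> G \<longrightarrow> x i = 0) \<and> (\<forall>e>0. finite {i. \<bar>x i\<bar> \<ge> e})},
                 (\<lambda>x. SUP i. \<bar>x i\<bar>))"

definition CK_space :: "'a topology \<Rightarrow> 'a nspace" where
  "CK_space K = ({f. continuous_map K euclideanreal f \<and> (\<forall>x. x \<notin> topspace K \<longrightarrow> f x = 0)},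
                 (\<lambda>f. SUP x. \<bar>f x\<bar>))"

definition Lip0_space :: "'x nspace \<Rightarrow> ('x \<Rightarrow> real) nspace" where
  "Lip0_space X = (case X of (V, N) \<Rightarrow>
     ({F. F (\<lambda>_. 0) = 0 \<and> (\<forall>x. x \<notin> V \<longrightarrow> F x = 0) \<and>
          (\<exists>L. \<forall>x\<in>V. \<forall>y\<in>V. \<bar>F x - F y\<bar> \<le> L * N (\<lambda>i. x i - y i))},
      (\<lambda>F. Inf {L. 0 \<le> L \<and> (\<forall>x\<in>V. \<forall>y\<in>V. \<bar>F x - F y\<bar> \<le> L * N (\<lambda>i. x i - y i))})))"

definition lin_on :: "('x \<Rightarrow> real) set \<Rightarrow> (('x \<Rightarrow> real) \<Rightarrow> ('y \<Rightarrow> real)) \<Rightarrow> bool" where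
  "lin_on V T \<longleftrightarrow> (\<forall>x\<in>V. \<forall>y\<in>V. T (\<lambda>i. x i + y i) = (\<lambda>j. T x j + T y j)) \<and>
                  (\<forall>x\<in>V. \<forall>c::real. T (\<lambda>i. c * x i) = (\<lambda>j. c * T x j))"

definition banach_iso :: "'x nspace \<Rightarrow> 'y nspace \<Rightarrow> bool" where
  "banach_iso X Y = (case X of (V1, N1) \<Rightarrow> case Y of (V2, N2) \<Rightarrow>
     (\<exists>T C. bij_betw T V1 V2 \<and> lin_on V1 T \<and>
        (\<forall>x\<in>V1. N2 (T x) \<le> C * N1 x \<and> N1 x \<le> C * N2 (T x))))"

definition compl_embeds :: "'x nspace \<Rightarrow> 'y nspace \<Rightarrow> bool" where
  "compl_embeds X Y = (case X of (V1, N1) \<Rightarrow> case Y of (V2, N2) \<Rightarrow>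
     (\<exists>T P C. T ` V1 \<subseteq> V2 \<and> lin_on V1 T \<and>
        (\<forall>x\<in>V1. N2 (T x) \<le> C * N1 x \<and> N1 x \<le> C * N2 (T x)) \<and>
        P ` V2 = T ` V1 \<and> lin_on V2 P \<and> (\<forall>y\<in>T ` V1. P y = y) \<and>
        (\<forall>y\<in>V2. N2 (P y) \<le> C * N2 y)))"

end

theory Submission
  imports Defs
begin

text \<open>
  If \<open>T\<close> and \<open>S\<close> are bounded linear maps between two spaces with \<open>S T = id\<close>, then the first
  space is complemented in the second. For a Lipschitz retract, composing with the retraction
  and restricting give such a pair on \<open>Lip0\<close>. On the one hand, \<open>c0\<close> is a Lipschitz retract
  of the bounded families, and normalized bumps supported in the members of the cellular family
  span a copy of \<open>c0\<close> in \<open>C(K)\<close> on which evaluation at the peaks retracts.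

  On the other hand, \<open>C(K)\<close> need not be bi-Lipschitz embeddable into any \<open>c0\<close>. For a
  zero-dimensional \<open>L\<close>, however, the finite clopen algebras approximate the identity of \<open>C(L)\<close>
  by maps through finite-dimensional subspaces of \<open>c0\<close>. Copies of \<open>\<Phi>\<close> composed with all of
  these maps, rescaled, fit into disjoint balls of \<open>c0\<close>, and \<open>\<Phi>\<close> is recovered by a
  generalized limit over the net. There is room for this in \<open>c0(\<kappa>)\<close> because the clopen sets of \<open>L\<close>
  give a separated family in \<open>C(K)\<close>, hence number at most \<open>\<kappa>\<close> if \<open>\<kappa>\<close> is infinite; if
  \<open>\<kappa>\<close> is finite, then \<open>K\<close> is finite and discrete.
\<close>

subsection \<open>Lipschitz function spaces and factorizations\<close>

definition bounded_fun :: "('x \<Rightarrow> real) \<Rightarrow> bool" where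
  "bounded_fun f \<longleftrightarrow> bdd_above (range (\<lambda>x. \<bar>f x\<bar>))"

text \<open>The supremum runs over the whole type; members of \<open>c0 G\<close> and
  \<open>CK K\<close> vanish off \<open>G\<close> and off the space, so on them it is the usual
  norm.\<close>

definition sup_norm :: "('x \<Rightarrow> real) \<Rightarrow> real" where
  "sup_norm f = (SUP x. \<bar>f x\<bar>)"

abbreviation sup_dist :: "('x \<Rightarrow> real) \<Rightarrow> ('x \<Rightarrow> real) \<Rightarrow> real" where
  "sup_dist f g \<equiv> sup_norm (\<lambda>x. f x - g x)"

lemma bounded_funI:
  assumes "\<And>x. \<bar>f x\<bar> \<le> c"
  shows "bounded_fun f"
  unfolding bounded_fun_def using assms by (rule bdd_aboveI2)

lemma bounded_funE:
  assumes "bounded_fun f"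
  obtains c where "\<And>x. \<bar>f x\<bar> \<le> c"
  using assms unfolding bounded_fun_def bdd_above_def by auto

lemma bounded_fun_zero [simp]: "bounded_fun (\<lambda>_. 0)"
  by (rule bounded_funI[of _ 0]) simp

lemma bounded_fun_diff [simp]:
  assumes "bounded_fun f" "bounded_fun g"
  shows "bounded_fun (\<lambda>x. f x - g x)"
proof -
  obtain b c where b: "\<And>x. \<bar>f x\<bar> \<le> b" and c: "\<And>x. \<bar>g x\<bar> \<le> c"
    using assms by (meson bounded_funE)
  have "\<bar>f x - g x\<bar> \<le> b + c" for x
    using b[of x] c[of x] by linarith
  then show ?thesis by (rule bounded_funI)
qed

lemma sup_norm_upper: "bounded_fun f \<Longrightarrow> \<bar>f x\<bar> \<le> sup_norm f"
  unfolding bounded_fun_def sup_norm_def by (rule cSUP_upper) auto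

lemma sup_norm_least: "(\<And>x. \<bar>f x\<bar> \<le> c) \<Longrightarrow> sup_norm f \<le> c"
  unfolding sup_norm_def by (rule cSUP_least) auto

lemma sup_norm_nonneg: "bounded_fun f \<Longrightarrow> 0 \<le> sup_norm f"
  by (meson abs_ge_zero order_trans sup_norm_upper)

lemma sup_norm_zero [simp]: "sup_norm (\<lambda>_. 0) = 0"
  by (simp add: sup_norm_def)

lemma sup_dist_upper:
  "bounded_fun f \<Longrightarrow> bounded_fun g \<Longrightarrow> \<bar>f x - g x\<bar> \<le> sup_dist f g"
  using sup_norm_upper[of "\<lambda>x. f x - g x" x] by simp

lemma sup_dist_commute: "sup_dist f g = sup_dist g f"
  by (simp add: sup_norm_def abs_minus_commute)

lemma sup_dist_triangle:
  assumes "bounded_fun f" "bounded_fun g" "bounded_fun h"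
  shows "sup_dist f h \<le> sup_dist f g + sup_dist g h"
proof (rule sup_norm_least)
  fix x
  show "\<bar>f x - h x\<bar> \<le> sup_dist f g + sup_dist g h"
    using sup_dist_upper[OF assms(1,2), of x] sup_dist_upper[OF assms(2,3), of x] by linarith
qed

text \<open>Boundedness makes \<open>sup_norm\<close> a genuine supremum on the carrier; the zero
  function is the base point for \<open>Lip0\<close>.\<close>

definition fun_space :: "('x \<Rightarrow> real) set \<Rightarrow> bool" where
  "fun_space V \<longleftrightarrow> (\<lambda>_. 0) \<in> V \<and> (\<forall>f\<in>V. bounded_fun f)"

lemma fun_space_zero: "fun_space V \<Longrightarrow> (\<lambda>_. 0) \<in> V"
  and fun_space_bounded: "fun_space V \<Longrightarrow> f \<in> V \<Longrightarrow> bounded_fun f"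
  by (auto simp: fun_space_def)

definition sup_lipschitz :: "real \<Rightarrow> ('x \<Rightarrow> real) set \<Rightarrow> (('x \<Rightarrow> real) \<Rightarrow> ('y \<Rightarrow> real)) \<Rightarrow> bool" where
  "sup_lipschitz c V i \<longleftrightarrow> (\<forall>x\<in>V. \<forall>y\<in>V. sup_dist (i x) (i y) \<le> c * sup_dist x y)"

abbreviation Lip0 :: "('x \<Rightarrow> real) set \<Rightarrow> ('x \<Rightarrow> real) nspace" where
  "Lip0 V \<equiv> Lip0_space (V, sup_norm)"

lemma Lip0_memI:
  assumes "F (\<lambda>_. 0) = 0" "\<And>x. x \<notin> V \<Longrightarrow> F x = 0"
    "\<And>x y. x \<in> V \<Longrightarrow> y \<in> V \<Longrightarrow> \<bar>F x - F y\<bar> \<le> L * sup_dist x y"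
  shows "F \<in> fst (Lip0 V)"
  using assms unfolding Lip0_space_def by auto

lemma Lip0_zero: "F \<in> fst (Lip0 V) \<Longrightarrow> F (\<lambda>_. 0) = 0"
  and Lip0_outside: "F \<in> fst (Lip0 V) \<Longrightarrow> x \<notin> V \<Longrightarrow> F x = 0"
  unfolding Lip0_space_def by auto

lemma Lip0_norm_le:
  assumes "0 \<le> L" "\<And>x y. x \<in> V \<Longrightarrow> y \<in> V \<Longrightarrow> \<bar>F x - F y\<bar> \<le> L * sup_dist x y"
  shows "snd (Lip0 V) F \<le> L"
  using assms unfolding Lip0_space_def by (auto intro!: cInf_lower bdd_belowI[of _ 0])

text \<open>Dividing by a positive \<open>sup_dist x y\<close> turns the estimate into a lower bound
  for all admissible constants, hence for their infimum; at distance zero any one constant forces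
  equal values.\<close>

lemma
  assumes V: "fun_space V" and F: "F \<in> fst (Lip0 V)"
  shows Lip0_norm_nonneg: "0 \<le> snd (Lip0 V) F"
    and Lip0_lipschitz: "x \<in> V \<Longrightarrow> y \<in> V \<Longrightarrow> \<bar>F x - F y\<bar> \<le> snd (Lip0 V) F * sup_dist x y"
proof -
  define S where "S = {L. 0 \<le> L \<and> (\<forall>x\<in>V. \<forall>y\<in>V. \<bar>F x - F y\<bar> \<le> L * sup_dist x y)}"
  have eq: "snd (Lip0 V) F = Inf S"
    by (simp add: Lip0_space_def S_def)
  have d: "0 \<le> sup_dist x y" if "x \<in> V" "y \<in> V" for x y
    using that V by (simp add: fun_space_bounded sup_norm_nonneg)
  obtain L where L: "\<forall>x\<in>V. \<forall>y\<in>V. \<bar>F x - F y\<bar> \<le> L * sup_dist x y"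
    using F unfolding Lip0_space_def by auto
  \<comment> \<open>Membership in \<open>Lip0\<close> leaves the sign of \<open>L\<close> open,
    whereas the norm ranges over nonnegative constants.\<close>
  have "\<bar>L\<bar> \<in> S"
    unfolding S_def using L d by (auto intro: order_trans[OF _ mult_right_mono[OF abs_ge_self]])
  then have ne: "S \<noteq> {}" by auto
  show "0 \<le> snd (Lip0 V) F"
    unfolding eq by (rule cInf_greatest[OF ne]) (simp add: S_def)
  show "\<bar>F x - F y\<bar> \<le> snd (Lip0 V) F * sup_dist x y" if xy: "x \<in> V" "y \<in> V"
  proof (cases "sup_dist x y = 0")
    case True
    then show ?thesis using L xy by force
  next
    case False
    then have pos: "0 < sup_dist x y" using d[OF xy] by simp
    have "\<bar>F x - F y\<bar> / sup_dist x y \<le> Inf S"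
      by (rule cInf_greatest[OF ne]) (use pos xy in \<open>auto simp: S_def pos_divide_le_eq\<close>)
    then show ?thesis
      unfolding eq using pos by (simp add: pos_divide_le_eq)
  qed
qed

text \<open>If \<open>S T\<close> is the identity, then \<open>T\<close> is an isomorphic embedding with complemented
  range, the projection being \<open>T S\<close>.\<close>

definition factors :: "'x nspace \<Rightarrow> 'y nspace \<Rightarrow> bool" where
  "factors X Y \<longleftrightarrow> (\<exists>T S C. 0 \<le> C \<and> T ` fst X \<subseteq> fst Y \<and> S ` fst Y \<subseteq> fst X \<and>
     lin_on (fst X) T \<and> lin_on (fst Y) S \<and>
     (\<forall>x\<in>fst X. snd Y (T x) \<le> C * snd X x) \<and> (\<forall>y\<in>fst Y. snd X (S y) \<le> C * snd Y y) \<and>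
     (\<forall>x\<in>fst X. S (T x) = x))"

lemma lin_on_comp:
  assumes "lin_on V T" "lin_on W S" "T ` V \<subseteq> W"
  shows "lin_on V (\<lambda>x. S (T x))"
  using assms unfolding lin_on_def by (simp add: image_subset_iff)

lemma factors_trans:
  assumes "factors X Y" "factors Y Z"
  shows "factors X Z"
proof -
  obtain T S C where 1: "0 \<le> C" "T ` fst X \<subseteq> fst Y" "S ` fst Y \<subseteq> fst X"
     "lin_on (fst X) T" "lin_on (fst Y) S"
     "\<forall>x\<in>fst X. snd Y (T x) \<le> C * snd X x" "\<forall>y\<in>fst Y. snd X (S y) \<le> C * snd Y y"
     "\<forall>x\<in>fst X. S (T x) = x"
    using assms(1) unfolding factors_def by blast
  obtain T' S' C' where 2: "0 \<le> C'" "T' ` fst Y \<subseteq> fst Z" "S' ` fst Z \<subseteq> fst Y"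
     "lin_on (fst Y) T'" "lin_on (fst Z) S'"
     "\<forall>x\<in>fst Y. snd Z (T' x) \<le> C' * snd Y x" "\<forall>y\<in>fst Z. snd Y (S' y) \<le> C' * snd Z y"
     "\<forall>x\<in>fst Y. S' (T' x) = x"
    using assms(2) unfolding factors_def by blast
  have "snd Z (T' (T x)) \<le> (C * C') * snd X x" if "x \<in> fst X" for x
  proof -
    have "snd Z (T' (T x)) \<le> C' * snd Y (T x)" using 1 2 that by auto
    also have "\<dots> \<le> C' * (C * snd X x)" using 1 2 that by (auto intro: mult_left_mono)
    finally show ?thesis by (simp add: mult_ac)
  qed
  moreover have "snd X (S (S' y)) \<le> (C * C') * snd Z y" if "y \<in> fst Z" for y
  proof -
    have "snd X (S (S' y)) \<le> C * snd Y (S' y)" using 1 2 that by auto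
    also have "\<dots> \<le> C * (C' * snd Z y)" using 1 2 that by (auto intro: mult_left_mono)
    finally show ?thesis by (simp add: mult_ac)
  qed
  moreover have "lin_on (fst X) (\<lambda>x. T' (T x))" "lin_on (fst Z) (\<lambda>y. S (S' y))"
    by (fact lin_on_comp[OF 1(4) 2(4) 1(2)] lin_on_comp[OF 2(5) 1(5) 2(3)])+
  moreover have "(\<lambda>x. T' (T x)) ` fst X \<subseteq> fst Z" "(\<lambda>y. S (S' y)) ` fst Z \<subseteq> fst X"
    using 1(2,3) 2(2,3) by (simp_all add: image_subset_iff)
  moreover have "S (S' (T' (T x))) = x" if "x \<in> fst X" for x
    using that 1(2,8) 2(8) by (simp add: image_subset_iff)
  ultimately show ?thesis
    unfolding factors_def using 1(1) 2(1)
    by (intro exI[of _ "\<lambda>x. T' (T x)"] exI[of _ "\<lambda>y. S (S' y)"] exI[of _ "C * C'"]) auto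
qed

lemma factors_imp_compl_embeds:
  assumes "factors X Y" and nn: "\<And>x. x \<in> fst X \<Longrightarrow> 0 \<le> snd X x" "\<And>y. y \<in> fst Y \<Longrightarrow> 0 \<le> snd Y y"
  shows "compl_embeds X Y"
proof -
  obtain T S C where 1: "0 \<le> C" "T ` fst X \<subseteq> fst Y" "S ` fst Y \<subseteq> fst X"
     "lin_on (fst X) T" "lin_on (fst Y) S"
     "\<forall>x\<in>fst X. snd Y (T x) \<le> C * snd X x" "\<forall>y\<in>fst Y. snd X (S y) \<le> C * snd Y y"
     "\<forall>x\<in>fst X. S (T x) = x"
    using assms(1) unfolding factors_def by blast
  \<comment> \<open>One constant has to serve all bounds: \<open>C\<close> for \<open>T\<close> from
    above and below, \<open>C * C\<close> for the projection.\<close>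
  define D where "D = C + C * C"
  have D: "C \<le> D" "C * C \<le> D" using 1(1) by (auto simp: D_def)
  have "snd Y (T x) \<le> D * snd X x" "snd X x \<le> D * snd Y (T x)" if x: "x \<in> fst X" for x
  proof -
    show "snd Y (T x) \<le> D * snd X x"
      using 1(6) x mult_right_mono[OF D(1) nn(1)[OF x]] by fastforce
    have "T x \<in> fst Y" using x 1 by auto
    then have "snd X (S (T x)) \<le> C * snd Y (T x)" using 1(7) by blast
    also have "\<dots> \<le> D * snd Y (T x)"
      using \<open>T x \<in> fst Y\<close> by (intro mult_right_mono D nn)
    finally show "snd X x \<le> D * snd Y (T x)" using 1(8) x by simp
  qed
  moreover have "(\<lambda>y. T (S y)) ` fst Y = T ` fst X"
  proof
    show "(\<lambda>y. T (S y)) ` fst Y \<subseteq> T ` fst X" using 1(3) by auto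
    show "T ` fst X \<subseteq> (\<lambda>y. T (S y)) ` fst Y"
    proof
      fix z assume "z \<in> T ` fst X"
      then obtain x where "x \<in> fst X" "z = T x" by auto
      then have "z = T (S (T x))" "T x \<in> fst Y" using 1 by auto
      then show "z \<in> (\<lambda>y. T (S y)) ` fst Y" by blast
    qed
  qed
  moreover have "snd Y (T (S y)) \<le> D * snd Y y" if y: "y \<in> fst Y" for y
  proof -
    have "snd Y (T (S y)) \<le> C * snd X (S y)" using 1 y by auto
    also have "\<dots> \<le> C * (C * snd Y y)" using 1 y by (auto intro: mult_left_mono)
    also have "\<dots> \<le> D * snd Y y"
      using mult_right_mono[OF D(2) nn(2)[OF y]] by (simp add: mult_ac)
    finally show ?thesis .
  qed
  moreover have "lin_on (fst Y) (\<lambda>y. T (S y))"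
    by (fact lin_on_comp[OF 1(5) 1(4) 1(3)])
  moreover have "\<forall>y\<in>T ` fst X. T (S y) = y" using 1(8) by auto
  ultimately show ?thesis
    unfolding compl_embeds_def case_prod_unfold using 1
    by (intro exI[of _ T] exI[of _ "\<lambda>y. T (S y)"] exI[of _ D]) auto
qed

lemma compl_embeds_Lip0:
  "factors (Lip0 V) (Lip0 W) \<Longrightarrow> fun_space V \<Longrightarrow> fun_space W \<Longrightarrow> compl_embeds (Lip0 V) (Lip0 W)"
  by (rule factors_imp_compl_embeds) (auto intro: Lip0_norm_nonneg)

text \<open>The case distinctions below reflect the convention that the elements of \<open>Lip0\<close> vanish
  outside the carrier.\<close>

lemma
  assumes V: "fun_space V" and W: "fun_space W" and r: "r ` W \<subseteq> V" "sup_lipschitz c W r"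
    and r0: "r (\<lambda>_. 0) = (\<lambda>_. 0)" and c: "0 \<le> c" and F: "F \<in> fst (Lip0 V)"
  defines "G \<equiv> \<lambda>y. if y \<in> W then F (r y) else 0"
  shows Lip0_compose: "G \<in> fst (Lip0 W)"
    and Lip0_compose_norm: "snd (Lip0 W) G \<le> c * snd (Lip0 V) F"
proof -
  have L: "\<bar>G x - G y\<bar> \<le> (c * snd (Lip0 V) F) * sup_dist x y" if "x \<in> W" "y \<in> W" for x y
  proof -
    have "\<bar>G x - G y\<bar> \<le> snd (Lip0 V) F * sup_dist (r x) (r y)"
      using Lip0_lipschitz[OF V F, of "r x" "r y"] that r by (auto simp: G_def)
    also have "\<dots> \<le> snd (Lip0 V) F * (c * sup_dist x y)"
      using r(2) that by (intro mult_left_mono Lip0_norm_nonneg V F) (auto simp: sup_lipschitz_def)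
    finally show ?thesis by (simp add: mult_ac)
  qed
  show "G \<in> fst (Lip0 W)"
    using L by (rule Lip0_memI[rotated 2]) (auto simp: G_def r0 Lip0_zero[OF F])
  show "snd (Lip0 W) G \<le> c * snd (Lip0 V) F"
    using L by (rule Lip0_norm_le[rotated]) (auto intro!: mult_nonneg_nonneg c Lip0_norm_nonneg V F)
qed

text \<open>Composition with a fixed map is linear in the function, so \<open>i\<close> and
  \<open>r\<close> themselves may be nonlinear. Composing with \<open>i\<close> undoes composing
  with \<open>r\<close>, because \<open>r\<close> after \<open>i\<close> is the identity.\<close>

lemma factors_lipschitz_retract:
  assumes V: "fun_space V" and W: "fun_space W"
    and i: "i ` V \<subseteq> W" "sup_lipschitz c V i" "i (\<lambda>_. 0) = (\<lambda>_. 0)"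
    and r: "r ` W \<subseteq> V" "sup_lipschitz c W r" "r (\<lambda>_. 0) = (\<lambda>_. 0)"
    and ri: "\<And>x. x \<in> V \<Longrightarrow> r (i x) = x" and c: "0 \<le> c"
  shows "factors (Lip0 V) (Lip0 W)"
  unfolding factors_def
proof (intro exI conjI ballI)
  let ?T = "\<lambda>F y. if y \<in> W then F (r y) else 0"
  let ?S = "\<lambda>G x. if x \<in> V then G (i x) else 0"
  show "0 \<le> c" by fact
  show "?T ` fst (Lip0 V) \<subseteq> fst (Lip0 W)"
    using Lip0_compose[OF V W r c] by auto
  show "?S ` fst (Lip0 W) \<subseteq> fst (Lip0 V)"
    using Lip0_compose[OF W V i c] by auto
  show "lin_on (fst (Lip0 V)) ?T" "lin_on (fst (Lip0 W)) ?S"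
    by (auto simp: lin_on_def)
  show "snd (Lip0 W) (?T F) \<le> c * snd (Lip0 V) F" if "F \<in> fst (Lip0 V)" for F
    using Lip0_compose_norm[OF V W r c that] .
  show "snd (Lip0 V) (?S F) \<le> c * snd (Lip0 W) F" if "F \<in> fst (Lip0 W)" for F
    using Lip0_compose_norm[OF W V i c that] .
  show "?S (?T F) = F" if "F \<in> fst (Lip0 V)" for F
    using i(1) by (auto simp: ri Lip0_outside[OF that] fun_eq_iff)
qed

subsection \<open>A complemented copy over a cellular family\<close>

definition c0 :: "'g set \<Rightarrow> ('g \<Rightarrow> real) set" where
  "c0 G = {x. (\<forall>i. i \<notin> G \<longrightarrow> x i = 0) \<and> (\<forall>e>0. finite {i. e \<le> \<bar>x i\<bar>})}"

definition CK :: "'a topology \<Rightarrow> ('a \<Rightarrow> real) set" where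
  "CK K = {f. continuous_map K euclideanreal f \<and> (\<forall>x. x \<notin> topspace K \<longrightarrow> f x = 0)}"

lemma c0_space_eq: "c0_space G = (c0 G, sup_norm)"
  by (simp add: c0_space_def c0_def sup_norm_def[abs_def])

lemma CK_space_eq: "CK_space K = (CK K, sup_norm)"
  by (simp add: CK_space_def CK_def sup_norm_def[abs_def])

lemma fun_space_c0: "fun_space (c0 G)"
  unfolding fun_space_def
proof (intro conjI ballI)
  show "(\<lambda>_. 0) \<in> c0 G" by (auto simp: c0_def)
next
  fix x assume "x \<in> c0 G"
  then have fin: "finite {i. 1 \<le> \<bar>x i\<bar>}" by (simp add: c0_def)
  define c where "c = Max (insert 1 ((\<lambda>i. \<bar>x i\<bar>) ` {i. 1 \<le> \<bar>x i\<bar>}))"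
  have "\<bar>x i\<bar> \<le> c" for i
  proof (cases "1 \<le> \<bar>x i\<bar>")
    case True
    then show ?thesis unfolding c_def using fin by (intro Max_ge) auto
  next
    case False
    moreover have "1 \<le> c" unfolding c_def using fin by (intro Max_ge) auto
    ultimately show ?thesis by simp
  qed
  then show "bounded_fun x" by (rule bounded_funI)
qed

lemma fun_space_CK:
  assumes "compact_space K"
  shows "fun_space (CK K)"
  unfolding fun_space_def
proof (intro conjI ballI)
  show "(\<lambda>_. 0) \<in> CK K" by (auto simp: CK_def)
next
  fix f assume f: "f \<in> CK K"
  then have "compactin euclideanreal (f ` topspace K)"
    using assms by (intro image_compactin[of K]) (auto simp: CK_def compact_space_def)
  then obtain c where c: "\<And>y. y \<in> f ` topspace K \<Longrightarrow> \<bar>y\<bar> \<le> c"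
    by (metis bounded_real compact_imp_bounded compactin_euclidean_iff)
  have "\<bar>f t\<bar> \<le> max c 0" for t
    using c[of "f t"] f by (cases "t \<in> topspace K") (auto simp: CK_def)
  then show "bounded_fun f" by (rule bounded_funI)
qed

lemma continuous_map_real_iff:
  "continuous_map K euclideanreal f \<longleftrightarrow>
    (\<forall>t\<in>topspace K. \<forall>e>0. \<exists>U. openin K U \<and> t \<in> U \<and> (\<forall>s\<in>U. \<bar>f s - f t\<bar> < e))"
  unfolding mtopology_is_euclidean[symmetric] Met_TC.continuous_map_to_metric
  by (simp add: dist_real_def abs_minus_commute)

text \<open>The usual e/3 argument for uniform limits, phrased by approximability so that no
  sequence has to be chosen.\<close>

lemma continuous_map_real_approx:
  assumes "\<And>e. 0 < e \<Longrightarrow> \<exists>g. continuous_map K euclideanreal g \<and> (\<forall>t\<in>topspace K. \<bar>f t - g t\<bar> \<le> e)"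
  shows "continuous_map K euclideanreal f"
  unfolding continuous_map_real_iff
proof (intro ballI allI impI)
  fix t and e :: real assume t: "t \<in> topspace K" and e: "0 < e"
  obtain g where g: "continuous_map K euclideanreal g" "\<And>t. t \<in> topspace K \<Longrightarrow> \<bar>f t - g t\<bar> \<le> e/3"
    using assms[of "e/3"] e by auto
  obtain U where U: "openin K U" "t \<in> U" "\<And>s. s \<in> U \<Longrightarrow> \<bar>g s - g t\<bar> < e/3"
    using g(1) t e unfolding continuous_map_real_iff by (meson divide_pos_pos zero_less_numeral)
  have "\<bar>f s - f t\<bar> < e" if "s \<in> U" for s
  proof -
    have "s \<in> topspace K" using openin_subset[OF U(1)] that by blast
    then show ?thesis using U(3)[OF that] g(2)[OF t] g(2)[of s] by linarith
  qed
  then show "\<exists>U. openin K U \<and> t \<in> U \<and> (\<forall>s\<in>U. \<bar>f s - f t\<bar> < e)"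
    using U by blast
qed

text \<open>The distance from a bounded family to \<open>c0\<close>; shrinking every coordinate towards 0 by
  that amount is a Lipschitz retraction onto \<open>c0\<close>.\<close>

definition tail_sup :: "('g \<Rightarrow> real) \<Rightarrow> real" where
  "tail_sup x = Inf {e. 0 \<le> e \<and> finite {i. e \<le> \<bar>x i\<bar>}}"

lemma tail_sup_ne:
  assumes "bounded_fun x"
  shows "{e. 0 \<le> e \<and> finite {i. e \<le> \<bar>x i\<bar>}} \<noteq> {}"
proof -
  obtain c where c: "\<And>i. \<bar>x i\<bar> \<le> c" using assms by (meson bounded_funE)
  then have "0 \<le> c" by (meson abs_ge_zero order_trans)
  moreover have "{i. c + 1 \<le> \<bar>x i\<bar>} = {}"
    using c by (force simp: not_le dest: le_less_trans)
  ultimately have "c + 1 \<in> {e. 0 \<le> e \<and> finite {i. e \<le> \<bar>x i\<bar>}}" by simp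
  then show ?thesis by blast
qed

lemma tail_sup_nonneg: "bounded_fun x \<Longrightarrow> 0 \<le> tail_sup x"
  unfolding tail_sup_def by (rule cInf_greatest[OF tail_sup_ne]) auto

lemma tail_sup_le: "0 \<le> e \<Longrightarrow> finite {i. e \<le> \<bar>x i\<bar>} \<Longrightarrow> tail_sup x \<le> e"
  unfolding tail_sup_def by (auto intro!: cInf_lower bdd_belowI[of _ 0])

lemma finite_above_tail_sup:
  assumes "bounded_fun x" "tail_sup x < e"
  shows "finite {i. e \<le> \<bar>x i\<bar>}"
proof -
  obtain e' where e': "e' < e" "finite {i. e' \<le> \<bar>x i\<bar>}"
    using cInf_lessD[OF tail_sup_ne[OF assms(1)]] assms(2) unfolding tail_sup_def by auto
  show ?thesis by (rule finite_subset[OF _ e'(2)]) (use e'(1) in auto)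
qed

lemma tail_sup_c0:
  assumes "x \<in> c0 G"
  shows "tail_sup x = 0"
proof (rule antisym)
  show "0 \<le> tail_sup x"
    using assms fun_space_bounded[OF fun_space_c0] by (blast intro: tail_sup_nonneg)
  have "tail_sup x \<le> e" if "0 < e" for e
    using assms that by (intro tail_sup_le) (auto simp: c0_def)
  then show "tail_sup x \<le> 0"
    by (metis field_le_epsilon add.left_neutral)
qed

text \<open>A threshold that leaves finitely many coordinates of \<open>y\<close> above it does the
  same for \<open>x\<close> once raised by the sup distance; then exchange \<open>x\<close> and
  \<open>y\<close>.\<close>

lemma tail_sup_lipschitz:
  assumes "bounded_fun x" "bounded_fun y"
  shows "\<bar>tail_sup x - tail_sup y\<bar> \<le> sup_dist x y"
proof -
  have "tail_sup x - sup_dist x y \<le> tail_sup y" if b: "bounded_fun x" "bounded_fun y" for x y :: "'a \<Rightarrow> real"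
    unfolding tail_sup_def[of y]
  proof (rule cInf_greatest[OF tail_sup_ne[OF b(2)]])
    fix e assume "e \<in> {e. 0 \<le> e \<and> finite {i. e \<le> \<bar>y i\<bar>}}"
    then have e: "0 \<le> e" "finite {i. e \<le> \<bar>y i\<bar>}" by auto
    have "{i. e + sup_dist x y \<le> \<bar>x i\<bar>} \<subseteq> {i. e \<le> \<bar>y i\<bar>}"
    proof
      fix i assume "i \<in> {i. e + sup_dist x y \<le> \<bar>x i\<bar>}"
      then show "i \<in> {i. e \<le> \<bar>y i\<bar>}" using sup_dist_upper[OF b, of i] by auto
    qed
    then have "tail_sup x \<le> e + sup_dist x y"
      using e sup_norm_nonneg[OF bounded_fun_diff[OF b]]
      by (intro tail_sup_le) (auto intro: finite_subset)
    then show "tail_sup x - sup_dist x y \<le> e" by simp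
  qed
  from this[OF assms] this[OF assms(2,1)] show ?thesis
    by (simp add: sup_dist_commute[of y x])
qed

text \<open>The subtracted term is the truncation of \<open>x i\<close> to [-t, t] with t =
  \<open>tail_sup x\<close>, so this is soft thresholding.\<close>

definition c0_retract :: "'g set \<Rightarrow> ('g \<Rightarrow> real) \<Rightarrow> 'g \<Rightarrow> real" where
  "c0_retract G x = (\<lambda>i. if i \<in> G then x i - max (- tail_sup x) (min (tail_sup x) (x i)) else 0)"

text \<open>A coordinate that still has size \<open>e\<close> after shrinking was at least
  \<open>tail_sup x + e\<close> before, which happens finitely often.\<close>

lemma c0_retract_in_c0:
  assumes "bounded_fun x"
  shows "c0_retract G x \<in> c0 G"
proof -
  have "finite {i. e \<le> \<bar>c0_retract G x i\<bar>}" if "0 < e" for e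
    by (rule finite_subset[OF _ finite_above_tail_sup[OF assms, of "tail_sup x + e"]])
       (use that tail_sup_nonneg[OF assms] in \<open>auto simp: c0_retract_def max_def min_def split: if_splits\<close>)
  then show ?thesis by (simp add: c0_def c0_retract_def)
qed

lemma c0_retract_id:
  assumes "x \<in> c0 G"
  shows "c0_retract G x = x"
  using assms by (auto simp: c0_retract_def tail_sup_c0 c0_def fun_eq_iff)

text \<open>One unit of the constant comes from the coordinate itself, the other from the change of
  the threshold \<open>tail_sup\<close>.\<close>

lemma c0_retract_lipschitz:
  assumes b: "bounded_fun x" "bounded_fun y"
  shows "sup_dist (c0_retract G x) (c0_retract G y) \<le> 2 * sup_dist x y"
proof (rule sup_norm_least)
  fix i
  have "\<bar>c0_retract G x i - c0_retract G y i\<bar> \<le> \<bar>x i - y i\<bar> + \<bar>tail_sup x - tail_sup y\<bar>"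
    using tail_sup_nonneg[OF b(1)] tail_sup_nonneg[OF b(2)]
    by (auto simp: c0_retract_def max_def min_def)
  then show "\<bar>c0_retract G x i - c0_retract G y i\<bar> \<le> 2 * sup_dist x y"
    using tail_sup_lipschitz[OF b] sup_dist_upper[OF b, of i] by linarith
qed

text \<open>Continuous bump functions with disjoint supports span an isometric copy of \<open>c0\<close>, and
  evaluation at their peaks, followed by the retraction of bounded families onto \<open>c0\<close>,
  retracts \<open>C(K)\<close> onto it.\<close>

lemma factors_c0_CK_of_bumps:
  fixes \<phi> :: "'g \<Rightarrow> 'a \<Rightarrow> real"
  assumes K: "compact_space K"
    and cont: "\<And>k. k \<in> G \<Longrightarrow> continuous_map K euclideanreal (\<phi> k)"
    and bnd: "\<And>k t. k \<in> G \<Longrightarrow> 0 \<le> \<phi> k t \<and> \<phi> k t \<le> 1"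
    and disj: "\<And>j k t. j \<in> G \<Longrightarrow> k \<in> G \<Longrightarrow> \<phi> j t \<noteq> 0 \<Longrightarrow> \<phi> k t \<noteq> 0 \<Longrightarrow> j = k"
    and peak: "\<And>k. k \<in> G \<Longrightarrow> p k \<in> topspace K \<and> \<phi> k (p k) = 1"
  shows "factors (Lip0 (c0 G)) (Lip0 (CK K))"
proof -
  define supp where "supp t = {k\<in>G. \<phi> k t \<noteq> 0}" for t
  \<comment> \<open>Disjointness leaves at most one index in \<open>supp t\<close>. Summing over
    \<open>G\<close> would not do: a sum over an infinite set is 0 by default.\<close>
  define i where "i a t = (if t \<in> topspace K then \<Sum>k\<in>supp t. a k * \<phi> k t else 0)"
    for a :: "'g \<Rightarrow> real" and t
  define r where "r f = c0_retract G (\<lambda>k. if k \<in> G then f (p k) else 0)" for f :: "'a \<Rightarrow> real"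
  have supp: "supp t = {} \<or> (\<exists>k\<in>G. supp t = {k})" for t
    using disj by (fastforce simp: supp_def)
  have i_diff: "\<bar>i a t - i b t\<bar> \<le> sup_dist a b" if "bounded_fun a" "bounded_fun b" for a b t
  proof (cases "t \<in> topspace K \<and> supp t \<noteq> {}")
    case True
    then obtain k where k: "k \<in> G" "supp t = {k}" using supp by blast
    then have "\<bar>i a t - i b t\<bar> = \<bar>a k - b k\<bar> * \<phi> k t"
      using True bnd[OF k(1)] by (simp add: i_def abs_mult flip: left_diff_distrib)
    also have "\<dots> \<le> \<bar>a k - b k\<bar>"
      using bnd[OF k(1)] by (simp add: mult_left_le)
    also have "\<dots> \<le> sup_dist a b" using that by (rule sup_dist_upper)
    finally show ?thesis .
  next
    case False
    then have "i a t - i b t = 0" by (auto simp: i_def)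
    then show ?thesis using that by (simp add: sup_norm_nonneg)
  qed
  have i_CK: "i a \<in> CK K" if a: "a \<in> c0 G" for a
  proof -
    have "continuous_map K euclideanreal (i a)"
    proof (rule continuous_map_real_approx)
      fix e :: real assume e: "0 < e"
      \<comment> \<open>Dropping the coefficients below \<open>e\<close> leaves a finite, hence
        continuous, sum; at each point at most one dropped term is nonzero, so the error is at most
        \<open>e\<close>.\<close>
      define F where "F = {k. e \<le> \<bar>a k\<bar>}"
      have F: "finite F" "F \<subseteq> G" using a e by (auto simp: c0_def F_def)
      define g where "g = (\<lambda>t. \<Sum>k\<in>F. a k * \<phi> k t)"
      have "continuous_map K euclideanreal g"
        unfolding g_def using F cont
        by (intro continuous_map_sum continuous_map_real_mult) auto
      moreover have "\<bar>i a t - g t\<bar> \<le> e" if t: "t \<in> topspace K" for t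
      proof -
        have "g t = (\<Sum>k\<in>F \<inter> supp t. a k * \<phi> k t)"
          unfolding g_def using F by (intro sum.mono_neutral_right) (auto simp: supp_def)
        moreover have "finite (supp t)" using supp[of t] by auto
        ultimately have "i a t - g t = (\<Sum>k\<in>supp t - F. a k * \<phi> k t)"
          using t sum.Int_Diff[of "supp t" "\<lambda>k. a k * \<phi> k t" F] by (simp add: i_def Int_commute)
        moreover have "\<bar>a k * \<phi> k t\<bar> \<le> e" if "k \<in> supp t - F" for k
        proof -
          have "\<bar>a k * \<phi> k t\<bar> \<le> \<bar>a k\<bar>"
            using bnd[of k t] that by (simp add: supp_def abs_mult mult_left_le)
          then show ?thesis using that by (simp add: F_def)
        qed
        moreover from supp[of t] have "\<bar>sum \<psi> (supp t - F)\<bar> \<le> e"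
          if "\<And>k. k \<in> supp t - F \<Longrightarrow> \<bar>\<psi> k\<bar> \<le> e" for \<psi>
        proof
          assume "supp t = {}"
          then show ?thesis using e by simp
        next
          assume "\<exists>k\<in>G. supp t = {k}"
          then obtain k where "supp t = {k}" by blast
          then show ?thesis using e that[of k] by (cases "k \<in> F") (simp_all add: insert_Diff_if)
        qed
        ultimately show ?thesis by simp
      qed
      ultimately show "\<exists>g. continuous_map K euclideanreal g \<and> (\<forall>t\<in>topspace K. \<bar>i a t - g t\<bar> \<le> e)"
        by blast
    qed
    then show ?thesis by (simp add: CK_def i_def)
  qed
  have r_bd: "bounded_fun (\<lambda>k. if k \<in> G then f (p k) else 0)" if "f \<in> CK K" for f
    using fun_space_bounded[OF fun_space_CK[OF K] that]
    by (intro bounded_funI[of _ "sup_norm f"]) (auto simp: sup_norm_upper sup_norm_nonneg)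
  have r_lip: "sup_dist (r f) (r g) \<le> 2 * sup_dist f g" if fg: "f \<in> CK K" "g \<in> CK K" for f g
  proof -
    have bd: "bounded_fun f" "bounded_fun g" using fun_space_bounded[OF fun_space_CK[OF K]] fg by auto
    have "sup_dist (\<lambda>k. if k \<in> G then f (p k) else 0) (\<lambda>k. if k \<in> G then g (p k) else 0) \<le> sup_dist f g"
      by (rule sup_norm_least) (use bd in \<open>auto simp: sup_dist_upper sup_norm_nonneg\<close>)
    then show ?thesis
      unfolding r_def using c0_retract_lipschitz[OF r_bd[OF fg(1)] r_bd[OF fg(2)], of G] by linarith
  qed
  show ?thesis
  \<comment> \<open>The 2 is the constant of \<open>c0_retract\<close>; \<open>i\<close> is even
    nonexpansive.\<close>
  proof (rule factors_lipschitz_retract[where i = i and r = r and c = 2])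
    show "i ` c0 G \<subseteq> CK K" using i_CK by auto
    show "sup_lipschitz 2 (c0 G) i"
      unfolding sup_lipschitz_def
    proof (intro ballI)
      fix a b assume "a \<in> c0 G" "b \<in> c0 G"
      then have bd: "bounded_fun a" "bounded_fun b" using fun_space_bounded[OF fun_space_c0] by auto
      have "sup_dist (i a) (i b) \<le> sup_dist a b" by (rule sup_norm_least) (rule i_diff[OF bd])
      then show "sup_dist (i a) (i b) \<le> 2 * sup_dist a b"
        using sup_norm_nonneg[OF bounded_fun_diff[OF bd]] by linarith
    qed
    show "i (\<lambda>_. 0) = (\<lambda>_. 0)" by (auto simp: i_def)
    show "r ` CK K \<subseteq> c0 G" unfolding r_def using c0_retract_in_c0[OF r_bd] by auto
    show "sup_lipschitz 2 (CK K) r" using r_lip by (simp add: sup_lipschitz_def)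
    show "r (\<lambda>_. 0) = (\<lambda>_. 0)"
      using c0_retract_id[OF fun_space_zero[OF fun_space_c0], of G] by (simp add: r_def if_distrib cong: if_cong)
    show "r (i a) = a" if a: "a \<in> c0 G" for a
    proof -
      have "i a (p k) = a k" if "k \<in> G" for k
      proof -
        have "k \<in> supp (p k)" using peak[OF that] that by (simp add: supp_def)
        then have "supp (p k) = {k}" using supp[of "p k"] by (metis emptyE singletonD)
        then show ?thesis using peak[OF that] by (simp add: i_def)
      qed
      then have "(\<lambda>k. if k \<in> G then i a (p k) else 0) = a" using a by (auto simp: c0_def)
      then show ?thesis unfolding r_def using c0_retract_id[OF a] by simp
    qed
  qed (simp_all add: fun_space_c0 fun_space_CK K)
qed

text \<open>A compact Hausdorff space is normal, so Urysohn's lemma separates a point of each member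
  from the complement of that member. Disjoint members then carry bumps with disjoint
  supports.\<close>

theorem factors_c0_CK_of_cellular:
  assumes K: "compact_space K" "Hausdorff_space K" and U: "cellular K U" "U \<approx> G"
  shows "factors (Lip0 (c0 G)) (Lip0 (CK K))"
proof -
  obtain h where h: "bij_betw h G U" using U(2) eqpoll_sym unfolding eqpoll_def by blast
  have hU: "openin K (h k)" "h k \<noteq> {}" if "k \<in> G" for k
    using U(1) bij_betwE[OF h] that by (auto simp: cellular_def)
  have dis: "j = k" if "j \<in> G" "k \<in> G" "t \<in> h j" "t \<in> h k" for j k t
  proof -
    have "h j \<in> U" "h k \<in> U" using bij_betwE[OF h] that by auto
    then have "h j = h k" using U(1) that(3,4) unfolding cellular_def by blast
    then show ?thesis using h that by (auto simp: bij_betw_def inj_on_def)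
  qed
  have "\<exists>f t. t \<in> topspace K \<and> continuous_map K euclideanreal f \<and> (\<forall>s. 0 \<le> f s \<and> f s \<le> 1) \<and>
      (\<forall>s. s \<notin> h k \<longrightarrow> f s = 0) \<and> f t = 1" if k: "k \<in> G" for k
  proof -
    obtain t where t: "t \<in> h k" using hU(2)[OF k] by blast
    have tK: "t \<in> topspace K" using t openin_subset[OF hU(1)[OF k]] by blast
    have "normal_space K" using K by (simp add: compact_Hausdorff_or_regular_imp_normal_space)
    moreover have "closedin K {t}"
      using K(2) tK by (simp add: Hausdorff_imp_t1_space closedin_t1_singleton)
    moreover have "closedin K (topspace K - h k)" using hU(1)[OF k] by (rule openin_closedin_eq[THEN iffD1, THEN conjunct2])
    ultimately obtain f where f: "continuous_map K (top_of_set {0..1::real}) f"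
        "f ` (topspace K - h k) \<subseteq> {0}" "f ` {t} \<subseteq> {1}"
      using Urysohn_lemma[of K "topspace K - h k" "{t}" 0 1] t by (auto simp: disjnt_def)
    \<comment> \<open>Urysohn's function is controlled only on the space; the value 0 outside makes
      the bounds hold at every point of the type.\<close>
    define g where "g s = (if s \<in> topspace K then f s else 0)" for s
    have "continuous_map K euclideanreal g"
      using f(1) by (auto intro: continuous_map_eq[of K _ f] simp: g_def continuous_map_in_subtopology)
    moreover have "0 \<le> g s \<and> g s \<le> 1" for s
      using f(1) by (auto simp: g_def continuous_map_in_subtopology)
    moreover have "g s = 0" if "s \<notin> h k" for s using f(2) that by (auto simp: g_def)
    moreover have "g t = 1" using f(3) tK by (simp add: g_def)
    ultimately show ?thesis using tK by blast
  qed
  then obtain \<phi> p where \<phi>: "\<And>k. k \<in> G \<Longrightarrow> p k \<in> topspace K \<and> continuous_map K euclideanreal (\<phi> k) \<and>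
      (\<forall>s. 0 \<le> \<phi> k s \<and> \<phi> k s \<le> 1) \<and> (\<forall>s. s \<notin> h k \<longrightarrow> \<phi> k s = 0) \<and> \<phi> k (p k) = 1"
    by metis
  show ?thesis
  proof (rule factors_c0_CK_of_bumps[OF K(1), where \<phi> = \<phi> and p = p])
    show "j = k" if "j \<in> G" "k \<in> G" "\<phi> j t \<noteq> 0" "\<phi> k t \<noteq> 0" for j k t
      using dis[OF that(1,2), of t] \<phi>[OF that(1)] \<phi>[OF that(2)] that(3,4) by metis
  qed (use \<phi> in auto)
qed

subsection \<open>Generalized limits and cardinality\<close>

text \<open>A maximal proper filter converges along every bounded real function, which yields
  linear limits of bounded nets.\<close>

lemma ex_finer_filter_with_limits:
  assumes "F \<noteq> bot"
  shows "\<exists>U. U \<noteq> bot \<and> U \<le> F \<and>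
    (\<forall>(h :: 'j \<Rightarrow> real) c. (\<forall>\<^sub>F j in U. \<bar>h j\<bar> \<le> c) \<longrightarrow> (\<exists>l. (h \<longlongrightarrow> l) U))"
proof -
  define A where "A = {H. H \<noteq> bot \<and> H \<le> F}"
  have "\<exists>U\<in>A. \<forall>H\<in>A. H \<le> U \<longrightarrow> H = U"
  \<comment> \<open>Zorn's lemma in the reversed order, so chains need lower bounds. The infimum is
    proper, because whatever holds eventually along it already does so along one member.\<close>
  proof (rule predicate_Zorn[where P = "\<lambda>a b. b \<le> a"])
    show "partial_order_on A (relation_of (\<lambda>a b. b \<le> a) A)"
      by (auto simp: partial_order_on_def preorder_on_def relation_of_def
          intro!: refl_onI transI antisymI)
    fix C assume C: "C \<in> Chains (relation_of (\<lambda>a b. b \<le> a) A)"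
    then have sub: "C \<subseteq> A" and chain: "\<And>a b. a \<in> C \<Longrightarrow> b \<in> C \<Longrightarrow> a \<le> b \<or> b \<le> a"
      by (auto simp: Chains_def relation_of_def)
    show "\<exists>u\<in>A. \<forall>a\<in>C. u \<le> a"
    proof (cases "C = {}")
      case True
      then show ?thesis using assms by (auto simp: A_def)
    next
      case False
      have "eventually P (Inf C) \<longleftrightarrow> (\<exists>H\<in>C. eventually P H)" for P
        by (rule eventually_Inf_base[OF False]) (use chain in \<open>auto simp: le_inf_iff\<close>)
      then have "Inf C \<noteq> bot"
        using sub by (auto simp: A_def trivial_limit_def[symmetric] simp flip: eventually_False)
      moreover have "Inf C \<le> F" using False sub by (auto simp: A_def intro: Inf_lower2)
      ultimately show ?thesis by (auto simp: A_def Inf_lower)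
    qed
  qed
  then obtain U where U: "U \<noteq> bot" "U \<le> F"
    and max: "\<And>H. H \<noteq> bot \<Longrightarrow> H \<le> U \<Longrightarrow> H = U"
    unfolding A_def by (metis (mono_tags, lifting) mem_Collect_eq order_trans)
  have "\<exists>l. (h \<longlongrightarrow> l) U" if h: "\<forall>\<^sub>F j in U. \<bar>h j\<bar> \<le> c" for h :: "'j \<Rightarrow> real" and c
  proof -
    \<comment> \<open>The image filter lives on a compact interval and has a cluster point
      \<open>l\<close>. Pulling the neighbourhoods of \<open>l\<close> back refines \<open>U\<close>
      to a proper filter, which by maximality is \<open>U\<close> itself.\<close>
    have "filtermap h U \<noteq> bot" using U by (simp add: filtermap_bot_iff)
    moreover have "eventually (\<lambda>y. y \<in> {-c..c}) (filtermap h U)"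
      unfolding eventually_filtermap by (rule eventually_mono[OF h]) auto
    ultimately obtain l where l: "inf (nhds l) (filtermap h U) \<noteq> bot"
      using compact_Icc[of "-c" c] unfolding compact_filter by blast
    have "inf U (filtercomap h (nhds l)) \<noteq> bot"
    proof
      assume "inf U (filtercomap h (nhds l)) = bot"
      then have "eventually (\<lambda>_. False) (inf U (filtercomap h (nhds l)))" by simp
      then obtain P Q where PQ: "eventually P U" "eventually Q (nhds l)" "\<And>j. P j \<Longrightarrow> \<not> Q (h j)"
        unfolding eventually_inf eventually_filtercomap by blast
      have "eventually (\<lambda>y. \<not> Q y) (filtermap h U)"
        unfolding eventually_filtermap by (rule eventually_mono[OF PQ(1)]) (rule PQ(3))
      then have "eventually (\<lambda>_. False) (inf (nhds l) (filtermap h U))"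
        unfolding eventually_inf using PQ(2) by blast
      then show False using l by (simp add: eventually_False)
    qed
    then have "inf U (filtercomap h (nhds l)) = U" by (rule max) simp
    then have "U \<le> filtercomap h (nhds l)" by (metis inf.cobounded2)
    then show ?thesis by (auto simp: filterlim_iff_le_filtercomap)
  qed
  with U show ?thesis by blast
qed

section \<open>Cardinality of finite subsets and of separated families\<close>

lemma infinite_times_lepoll:
  assumes "infinite A" "B \<lesssim> A" "C \<lesssim> A"
  shows "B \<times> C \<lesssim> A"
proof -
  have "A \<times> A \<approx> A"
    using card_of_Times_same_infinite[OF assms(1)] by (simp add: eqpoll_iff_card_of_ordIso)
  then show ?thesis
    using times_lepoll_mono[OF assms(2,3)] lepoll_trans2 by blast
qed

text \<open>Every finite subset is the set of entries of a list. Lists of a fixed length number at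
  most \<open>A\<close> by induction, and there are only countably many lengths.\<close>

lemma infinite_Fpow_lepoll:
  assumes A: "infinite A"
  shows "Fpow A \<lesssim> A"
proof -
  define Ls where "Ls n = {xs \<in> lists A. length xs = n}" for n
  have "Ls n \<lesssim> A" for n
  proof (induction n)
    case 0
    have "Ls 0 = {[]}" by (auto simp: Ls_def)
    then show ?case using A by (simp add: finite_lepoll_infinite)
  next
    case (Suc n)
    have "Ls (Suc n) \<subseteq> (\<lambda>(x, xs). x # xs) ` (A \<times> Ls n)"
      by (auto simp: Ls_def length_Suc_conv image_iff)
    then have "Ls (Suc n) \<lesssim> A \<times> Ls n" by (rule subset_image_lepoll)
    also have "\<dots> \<lesssim> A" by (rule infinite_times_lepoll[OF A lepoll_refl Suc])
    finally show ?case .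
  qed
  moreover have "(UNIV :: nat set) \<lesssim> A" using A by (simp add: infinite_le_lepoll)
  ultimately have "(\<Union>n. Ls n) \<lesssim> A"
    using card_of_UNION_ordLeq_infinite[OF A, of "UNIV :: nat set" Ls]
    by (simp add: lepoll_def card_of_ordLeq)
  moreover have "Fpow A \<subseteq> set ` (\<Union>n. Ls n)"
  proof
    fix X assume "X \<in> Fpow A"
    then obtain xs where "set xs = X" "X \<subseteq> A" unfolding Fpow_def by (auto dest: finite_list)
    then have "xs \<in> Ls (length xs)" by (auto simp: Ls_def)
    then show "X \<in> set ` (\<Union>n. Ls n)" using \<open>set xs = X\<close> by blast
  qed
  ultimately show ?thesis by (meson lepoll_trans subset_image_lepoll)
qed

lemma is_base_nbhd:
  assumes "is_base K B" "openin K U" "t \<in> U"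
  obtains V where "V \<in> B" "t \<in> V" "V \<subseteq> U"
  using assms unfolding is_base_def by (metis Union_upper UnionE in_mono)

text \<open>A function is determined up to a given error by a finite cover from the base together
  with an approximate rational value on each member.\<close>

lemma separated_lepoll_base:
  assumes K: "compact_space K" and B: "is_base K B" "infinite B" and d: "0 < d"
    and S: "S \<subseteq> CK K" and sep: "\<And>f g. f \<in> S \<Longrightarrow> g \<in> S \<Longrightarrow> f \<noteq> g \<Longrightarrow> d \<le> sup_dist f g"
  shows "S \<lesssim> B"
proof -
  have ex: "\<exists>D. D \<in> Fpow (B \<times> \<rat>) \<and> topspace K \<subseteq> \<Union>(fst ` D) \<and> (\<forall>(V, q)\<in>D. \<forall>t\<in>V. \<bar>f t - q\<bar> < d/3)"
    if "f \<in> S" for f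
  proof -
    have f: "continuous_map K euclideanreal f" using that S by (auto simp: CK_def)
    \<comment> \<open>An error d/6 from the rational value and d/6 from the oscillation of
      \<open>f\<close> give d/3, so two functions with the same finite record differ by at most
      2d/3, less than the separation \<open>d\<close>.\<close>
    define E where "E = {(V, q). V \<in> B \<and> q \<in> \<rat> \<and> (\<forall>t\<in>V. \<bar>f t - q\<bar> < d/3)}"
    have "\<exists>V\<in>fst ` E. t \<in> V" if t: "t \<in> topspace K" for t
    proof -
      obtain q where q: "q \<in> \<rat>" "f t - d/6 < q" "q < f t + d/6"
        using Rats_dense_in_real[of "f t - d/6" "f t + d/6"] d by auto
      have "0 < d/6" using d by simp
      then obtain U where U: "openin K U" "t \<in> U" "\<forall>s\<in>U. \<bar>f s - f t\<bar> < d/6"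
        using f t unfolding continuous_map_real_iff by blast
      obtain V where V: "V \<in> B" "t \<in> V" "V \<subseteq> U" using is_base_nbhd[OF B(1) U(1,2)] .
      have "\<bar>f s - q\<bar> < d/3" if "s \<in> V" for s
      proof -
        have "\<bar>f s - f t\<bar> < d/6" using U(3) V(3) that by blast
        then show ?thesis using q by linarith
      qed
      then have "(V, q) \<in> E" using V q by (simp add: E_def)
      then show ?thesis using V(2) by force
    qed
    moreover have "\<forall>V\<in>fst ` E. openin K V" using B(1) by (auto simp: E_def is_base_def)
    ultimately obtain W where W: "finite W" "W \<subseteq> fst ` E" "topspace K \<subseteq> \<Union>W"
      using K unfolding compact_space_alt by (metis (no_types, lifting) UnionI subsetI)
    obtain D where D: "D \<subseteq> E" "finite D" "W = fst ` D"
      using finite_subset_image[OF W(1,2)] by blast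
    have "D \<in> Fpow (B \<times> \<rat>)" using D by (auto simp: Fpow_def E_def)
    moreover have "\<forall>(V, q)\<in>D. \<forall>t\<in>V. \<bar>f t - q\<bar> < d/3" using D(1) by (auto simp: E_def)
    ultimately show ?thesis using W(3) D(3) by blast
  qed
  then obtain D where D: "\<And>f. f \<in> S \<Longrightarrow> D f \<in> Fpow (B \<times> \<rat>)"
    "\<And>f. f \<in> S \<Longrightarrow> topspace K \<subseteq> \<Union>(fst ` D f)"
    "\<And>f V q t. f \<in> S \<Longrightarrow> (V, q) \<in> D f \<Longrightarrow> t \<in> V \<Longrightarrow> \<bar>f t - q\<bar> < d/3"
    by (metis (no_types, lifting) case_prodD)
  have "inj_on D S"
  proof (rule inj_onI, rule ccontr)
    fix f g assume fg: "f \<in> S" "g \<in> S" "D f = D g" "f \<noteq> g"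
    have "\<bar>f t - g t\<bar> \<le> 2 * d / 3" for t
    proof (cases "t \<in> topspace K")
      case True
      then obtain V q where "(V, q) \<in> D f" "t \<in> V" using D(2)[OF fg(1)] by fastforce
      then have "\<bar>f t - q\<bar> < d/3" "\<bar>g t - q\<bar> < d/3" using D(3) fg by auto
      then show ?thesis by linarith
    next
      case False
      then have "f t = 0" "g t = 0" using fg S by (auto simp: CK_def)
      then show ?thesis using d by simp
    qed
    then have "sup_dist f g \<le> 2 * d / 3" by (rule sup_norm_least)
    then show False using sep[OF fg(1,2,4)] d by linarith
  qed
  then have "S \<lesssim> Fpow (B \<times> (\<rat> :: real set))" unfolding lepoll_def using D(1) by blast
  also have "\<dots> \<lesssim> B \<times> (\<rat> :: real set)"
    using B(2) by (intro infinite_Fpow_lepoll) (auto simp: finite_cartesian_product_iff)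
  also have "\<dots> \<lesssim> B"
  proof (rule infinite_times_lepoll[OF B(2) lepoll_refl])
    have "(\<rat> :: real set) \<lesssim> (UNIV :: nat set)"
      using countable_rat unfolding countable_def lepoll_def by blast
    then show "(\<rat> :: real set) \<lesssim> B" using B(2) by (meson infinite_le_lepoll lepoll_trans)
  qed
  finally show ?thesis .
qed

subsection \<open>Approximate factorizations through balls of \<open>c0\<close>\<close>

lemma c0_diff:
  assumes "x \<in> c0 G" "y \<in> c0 G"
  shows "(\<lambda>i. x i - y i) \<in> c0 G"
proof -
  have "finite {i. e \<le> \<bar>x i - y i\<bar>}" if "0 < e" for e
  proof (rule finite_subset)
    show "{i. e \<le> \<bar>x i - y i\<bar>} \<subseteq> {i. e/2 \<le> \<bar>x i\<bar>} \<union> {i. e/2 \<le> \<bar>y i\<bar>}"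
      by auto
    have "finite {i. e/2 \<le> \<bar>x i\<bar>}" "finite {i. e/2 \<le> \<bar>y i\<bar>}"
      using assms half_gt_zero[OF that] unfolding c0_def by blast+
    then show "finite ({i. e/2 \<le> \<bar>x i\<bar>} \<union> {i. e/2 \<le> \<bar>y i\<bar>})" by (rule finite_UnI)
  qed
  then show ?thesis using assms by (simp add: c0_def)
qed

lemma c0_finite_support:
  assumes "finite A" "A \<subseteq> G" "\<And>i. i \<notin> A \<Longrightarrow> x i = 0"
  shows "x \<in> c0 G"
proof -
  have "finite {i. e \<le> \<bar>x i\<bar>}" if "0 < e" for e
    by (rule finite_subset[OF _ assms(1)]) (use assms(3) that in force)
  then show ?thesis using assms(2,3) by (auto simp: c0_def)
qed

text \<open>Suppose the identity of \<open>V\<close> is a limit of compositions \<open>A j \<circ> b j\<close> through the unit ball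
  of \<open>c0\<close>, the Lipschitz constants of the two factors being inverse to each other. Placing a
  copy of the \<open>j\<close>-th ball around \<open>4 e\<^sub>j\<close>, where \<open>e\<^sub>j\<close> is a unit vector, makes room for all
  the functions \<open>\<Phi> \<circ> A j\<close> at the same time, and \<open>\<Phi>\<close> is recovered as the limit of their
  compositions with \<open>b j\<close>.\<close>

theorem factors_c0_of_approximate_factorizations:
  fixes V :: "('x \<Rightarrow> real) set" and G :: "'g set" and F :: "'j filter"
    and A :: "'j \<Rightarrow> ('g \<Rightarrow> real) \<Rightarrow> 'x \<Rightarrow> real" and b :: "'j \<Rightarrow> ('x \<Rightarrow> real) \<Rightarrow> 'g \<Rightarrow> real"
  assumes V: "fun_space V" and F: "F \<noteq> bot" "\<forall>\<^sub>F j in F. j \<in> J"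
    and e: "inj_on e J" "e ` J \<subseteq> G"
    and s: "\<And>j. j \<in> J \<Longrightarrow> 0 < s j"
    and A: "\<And>j. j \<in> J \<Longrightarrow> A j ` c0 G \<subseteq> V" "\<And>j. j \<in> J \<Longrightarrow> sup_lipschitz (s j) (c0 G) (A j)"
      "\<And>j. j \<in> J \<Longrightarrow> A j (\<lambda>_. 0) = (\<lambda>_. 0)"
    and b: "\<And>j. j \<in> J \<Longrightarrow> b j ` V \<subseteq> c0 G" "\<And>j. j \<in> J \<Longrightarrow> sup_lipschitz (1 / s j) V (b j)"
      "\<And>j. j \<in> J \<Longrightarrow> b j (\<lambda>_. 0) = (\<lambda>_. 0)"
      "\<And>j f. j \<in> J \<Longrightarrow> f \<in> V \<Longrightarrow> sup_norm (b j f) \<le> 1"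
    and conv: "\<And>f. f \<in> V \<Longrightarrow> ((\<lambda>j. sup_dist (A j (b j f)) f) \<longlongrightarrow> 0) F"
  shows "factors (Lip0 V) (Lip0 (c0 G))"
proof -
  obtain U where U: "U \<noteq> bot" "U \<le> F"
    and Ulim: "\<And>(h :: 'j \<Rightarrow> real) c. (\<forall>\<^sub>F j in U. \<bar>h j\<bar> \<le> c) \<Longrightarrow> \<exists>l. (h \<longlongrightarrow> l) U"
    using ex_finer_filter_with_limits[OF F(1)] by blast
  have UJ: "\<forall>\<^sub>F j in U. j \<in> J" using F(2) U(2) by (simp add: filter_leD)
  note c0_bd = fun_space_bounded[OF fun_space_c0[of G]]

  \<comment> \<open>Centres are 4 apart from each other and from the origin, so the open balls of
    radius 2 around them are disjoint and miss the origin.\<close>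
  define c where "c j = (\<lambda>i. if i = e j then 4 else 0 :: real)" for j
  have c_c0: "c j \<in> c0 G" if "j \<in> J" for j
    using that e(2) by (intro c0_finite_support[of "{e j}"]) (auto simp: c_def)
  have sh_c0: "(\<lambda>i. x i - c j i) \<in> c0 G" if "x \<in> c0 G" "j \<in> J" for x j
    using that c_c0 by (intro c0_diff)
  \<comment> \<open>A 1-Lipschitz cutoff: 1 on the unit ball around \<open>c j\<close>, 0 from
    distance 2 on.\<close>
  define \<beta> where "\<beta> j x = max 0 (min 1 (2 - sup_dist x (c j)))" for j x
  \<comment> \<open>Division by \<open>s j\<close> compensates the Lipschitz constant of
    \<open>A j\<close>, so all \<open>v \<Phi> j\<close> share the constant of
    \<open>\<Phi>\<close>.\<close>
  define v where "v \<Phi> j x = \<Phi> (A j (\<lambda>i. x i - c j i)) / s j" for \<Phi> :: "('x \<Rightarrow> real) \<Rightarrow> real" and j x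
  define u where "u \<Phi> j x = v \<Phi> j x * \<beta> j x" for \<Phi> j x
  define near where "near x = {j\<in>J. sup_dist x (c j) < 2}" for x
  define T where "T \<Phi> x = (if x \<in> c0 G then \<Sum>j\<in>near x. u \<Phi> j x else 0)" for \<Phi> x
  \<comment> \<open>The factor \<open>s j\<close> cancels the constant of \<open>b j\<close>, and
    subtracting the value at the centre makes the expression vanish at \<open>f = 0\<close>.
    Together they bound it uniformly in \<open>j\<close>, as the limit along \<open>U\<close>
    requires.\<close>
  define q where "q \<Psi> f j = s j * (\<Psi> (\<lambda>i. c j i + b j f i) - \<Psi> (c j))"
    for \<Psi> :: "('g \<Rightarrow> real) \<Rightarrow> real" and f j
  define S where "S \<Psi> f = (if f \<in> V then Lim U (q \<Psi> f) else 0)" for \<Psi> f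

  have near_unique: "j = k" if "x \<in> c0 G" "j \<in> near x" "k \<in> near x" for x j k
  proof (rule ccontr)
    assume "j \<noteq> k"
    then have "e j \<noteq> e k" using that e(1) by (auto simp: near_def inj_on_def)
    moreover have "\<bar>x (e j) - c l (e j)\<bar> < 2" if "l \<in> near x" for l
      using sup_dist_upper[OF c0_bd c0_bd, of x "c l" "e j"] that c_c0 \<open>x \<in> c0 G\<close>
      by (auto simp: near_def)
    from this[OF that(2)] this[OF that(3)]
    have "\<bar>x (e j) - c j (e j)\<bar> < 2" "\<bar>x (e j) - c k (e j)\<bar> < 2" .
    ultimately show False by (simp add: c_def)
  qed
  have near_fin: "finite (near x) \<and> card (near x) \<le> 1" if "x \<in> c0 G" for x
  proof (cases "near x = {}")
    case False
    then obtain j where "j \<in> near x" by blast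
    then have "near x = {j}" using near_unique[OF that] by blast
    then show ?thesis by simp
  qed simp
  have \<beta>_far: "\<beta> j x = 0" if "j \<in> J" "j \<notin> near x" for j x
    using that by (simp add: near_def \<beta>_def)

  have u_lip: "\<bar>u \<Phi> j x - u \<Phi> j y\<bar> \<le> 3 * snd (Lip0 V) \<Phi> * sup_dist x y"
    if \<Phi>: "\<Phi> \<in> fst (Lip0 V)" and j: "j \<in> J" and xy: "x \<in> c0 G" "y \<in> c0 G" for \<Phi> j x y
  proof -
    define L where "L = snd (Lip0 V) \<Phi>"
    have L: "0 \<le> L" unfolding L_def by (rule Lip0_norm_nonneg[OF V \<Phi>])
    have AV: "A j (\<lambda>i. x i - c j i) \<in> V" if "x \<in> c0 G" for x
      using A(1)[OF j] sh_c0[OF that j] by auto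
    have v_lip: "\<bar>v \<Phi> j x - v \<Phi> j y\<bar> \<le> L * sup_dist x y" if "x \<in> c0 G" "y \<in> c0 G" for x y
    proof -
      have "\<bar>\<Phi> (A j (\<lambda>i. x i - c j i)) - \<Phi> (A j (\<lambda>i. y i - c j i))\<bar>
          \<le> L * sup_dist (A j (\<lambda>i. x i - c j i)) (A j (\<lambda>i. y i - c j i))"
        unfolding L_def using that AV by (intro Lip0_lipschitz[OF V \<Phi>])
      also have "\<dots> \<le> L * (s j * sup_dist (\<lambda>i. x i - c j i) (\<lambda>i. y i - c j i))"
        by (intro mult_left_mono A(2)[OF j, unfolded sup_lipschitz_def, rule_format] sh_c0 that j L)
      finally show ?thesis
        using s[OF j] by (simp add: v_def abs_divide pos_divide_le_eq mult_ac flip: diff_divide_distrib)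
    qed
    have v_bd: "\<bar>v \<Phi> j x\<bar> \<le> L * sup_dist x (c j)" if "x \<in> c0 G" for x
      using v_lip[OF that c_c0[OF j]] by (simp add: v_def A(3)[OF j] Lip0_zero[OF \<Phi>])
    have \<beta>_lip: "\<bar>\<beta> j x - \<beta> j y\<bar> \<le> sup_dist x y" if "x \<in> c0 G" "y \<in> c0 G" for x y
      using sup_dist_triangle[OF c0_bd c0_bd c0_bd, OF that(1,2) c_c0[OF j]]
        sup_dist_triangle[OF c0_bd c0_bd c0_bd, OF that(2,1) c_c0[OF j]]
      by (auto simp: \<beta>_def sup_dist_commute[of y x])
    \<comment> \<open>Product rule with \<open>v\<close> evaluated at the point within distance 2 of
      \<open>c j\<close>, where it is at most 2L; the constant is L + 2L. If neither point is near,
      both values vanish.\<close>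
    have half: "\<bar>u \<Phi> j x - u \<Phi> j y\<bar> \<le> 3 * L * sup_dist x y"
      if x: "x \<in> c0 G" and y: "y \<in> c0 G" and n: "j \<in> near y" for x y
    proof -
      have "u \<Phi> j x - u \<Phi> j y = (v \<Phi> j x - v \<Phi> j y) * \<beta> j x + v \<Phi> j y * (\<beta> j x - \<beta> j y)"
        by (simp add: u_def algebra_simps)
      then have "\<bar>u \<Phi> j x - u \<Phi> j y\<bar> \<le> \<bar>v \<Phi> j x - v \<Phi> j y\<bar> * \<bar>\<beta> j x\<bar> + \<bar>v \<Phi> j y\<bar> * \<bar>\<beta> j x - \<beta> j y\<bar>"
        by (metis abs_mult abs_triangle_ineq)
      also have "\<dots> \<le> (L * sup_dist x y) * 1 + (L * 2) * sup_dist x y"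
      proof (intro add_mono mult_mono v_lip \<beta>_lip x y)
        have "\<bar>v \<Phi> j y\<bar> \<le> L * sup_dist y (c j)" by (rule v_bd[OF y])
        also have "\<dots> \<le> L * 2" using L n by (intro mult_left_mono) (auto simp: near_def)
        finally show "\<bar>v \<Phi> j y\<bar> \<le> L * 2" .
      qed (use L x y in \<open>auto simp: \<beta>_def sup_norm_nonneg c0_bd\<close>)
      finally show ?thesis by simp
    qed
    show ?thesis
    proof (cases "j \<in> near x \<or> j \<in> near y")
      case True
      then show ?thesis
        using half[OF xy] half[OF xy(2,1)]
        by (auto simp: L_def sup_dist_commute[of y x] abs_minus_commute)
    next
      case False
      then have "u \<Phi> j x = 0" "u \<Phi> j y = 0" using \<beta>_far[OF j] by (auto simp: u_def)
      then show ?thesis using L xy by (simp add: L_def sup_norm_nonneg c0_bd)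
    qed
  qed

  \<comment> \<open>At most one index is active at each of the two points, so at most two terms with
    constant 3 contribute.\<close>
  have T_lip: "\<bar>T \<Phi> x - T \<Phi> y\<bar> \<le> 6 * snd (Lip0 V) \<Phi> * sup_dist x y"
    if \<Phi>: "\<Phi> \<in> fst (Lip0 V)" and xy: "x \<in> c0 G" "y \<in> c0 G" for \<Phi> x y
  proof -
    define M where "M = near x \<union> near y"
    have M: "finite M" "M \<subseteq> J" "card M \<le> 2"
      using near_fin[OF xy(1)] near_fin[OF xy(2)] card_Un_le[of "near x" "near y"]
      by (auto simp: M_def near_def)
    have T_M: "T \<Phi> z = (\<Sum>j\<in>M. u \<Phi> j z)" if "z \<in> c0 G" "near z \<subseteq> M" for z
      unfolding T_def using that M \<beta>_far
      by (auto simp: u_def intro!: sum.mono_neutral_left)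
    have "T \<Phi> x - T \<Phi> y = (\<Sum>j\<in>M. u \<Phi> j x - u \<Phi> j y)"
      using T_M xy by (simp add: M_def sum_subtractf)
    also have "\<bar>\<dots>\<bar> \<le> (\<Sum>j\<in>M. 3 * snd (Lip0 V) \<Phi> * sup_dist x y)"
      using M(2) by (intro order_trans[OF sum_abs] sum_mono u_lip \<Phi> xy) auto
    also have "\<dots> = real (card M) * (3 * snd (Lip0 V) \<Phi> * sup_dist x y)" by simp
    also have "\<dots> \<le> 2 * (3 * snd (Lip0 V) \<Phi> * sup_dist x y)"
      using M(3) xy Lip0_norm_nonneg[OF V \<Phi>]
      by (intro mult_right_mono) (auto simp: sup_norm_nonneg c0_bd)
    finally show ?thesis by simp
  qed
  have T_zero: "T \<Phi> (\<lambda>_. 0) = 0" for \<Phi>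
  proof -
    have "4 \<le> sup_dist (\<lambda>_. 0) (c j)" if "j \<in> J" for j
      using sup_dist_upper[OF bounded_fun_zero c0_bd[OF c_c0[OF that]], of "e j"] by (simp add: c_def)
    then have "near (\<lambda>_. 0) = {}" by (force simp: near_def)
    then show ?thesis by (simp add: T_def)
  qed
  \<comment> \<open>On the unit ball around \<open>c j\<close> the cutoff is 1 and no other index is
    near.\<close>
  have T_ball: "T \<Phi> (\<lambda>i. c j i + y i) = \<Phi> (A j y) / s j"
    if j: "j \<in> J" and y: "y \<in> c0 G" "sup_norm y \<le> 1" for \<Phi> j y
  proof -
    have "(\<lambda>i. c j i + y i) = (\<lambda>i. c j i - (0 - y i))" by simp
    also have "\<dots> \<in> c0 G" by (intro c0_diff c_c0 j y fun_space_zero fun_space_c0)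
    finally have cy: "(\<lambda>i. c j i + y i) \<in> c0 G" .
    have "j \<in> near (\<lambda>i. c j i + y i)" using y j by (simp add: near_def)
    then have "near (\<lambda>i. c j i + y i) = {j}" using near_unique[OF cy] by blast
    then show ?thesis using cy y by (simp add: T_def u_def v_def \<beta>_def)
  qed

  have q_lip: "\<bar>q \<Psi> f j - q \<Psi> g j\<bar> \<le> snd (Lip0 (c0 G)) \<Psi> * sup_dist f g"
    if \<Psi>: "\<Psi> \<in> fst (Lip0 (c0 G))" and j: "j \<in> J" and fg: "f \<in> V" "g \<in> V" for \<Psi> f g j
  proof -
    have cb: "(\<lambda>i. c j i + b j f i) \<in> c0 G" if "f \<in> V" for f
    proof -
      have "b j f \<in> c0 G" using b(1)[OF j] that by blast
      then have "(\<lambda>i. c j i - (0 - b j f i)) \<in> c0 G"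
        by (intro c0_diff c_c0 j fun_space_zero fun_space_c0)
      then show ?thesis by simp
    qed
    have "\<bar>\<Psi> (\<lambda>i. c j i + b j f i) - \<Psi> (\<lambda>i. c j i + b j g i)\<bar>
        \<le> snd (Lip0 (c0 G)) \<Psi> * sup_dist (\<lambda>i. c j i + b j f i) (\<lambda>i. c j i + b j g i)"
      using fg by (intro Lip0_lipschitz[OF fun_space_c0 \<Psi>] cb)
    also have "\<dots> = snd (Lip0 (c0 G)) \<Psi> * sup_dist (b j f) (b j g)" by simp
    also have "\<dots> \<le> snd (Lip0 (c0 G)) \<Psi> * (1 / s j * sup_dist f g)"
      using b(2)[OF j] fg unfolding sup_lipschitz_def
      by (intro mult_left_mono Lip0_norm_nonneg[OF fun_space_c0 \<Psi>]) auto
    finally have "s j * \<bar>\<Psi> (\<lambda>i. c j i + b j f i) - \<Psi> (\<lambda>i. c j i + b j g i)\<bar>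
        \<le> snd (Lip0 (c0 G)) \<Psi> * sup_dist f g"
      using s[OF j] by (simp add: pos_le_divide_eq mult_ac)
    moreover have "q \<Psi> f j - q \<Psi> g j = s j * (\<Psi> (\<lambda>i. c j i + b j f i) - \<Psi> (\<lambda>i. c j i + b j g i))"
      by (simp add: q_def right_diff_distrib)
    ultimately show ?thesis using s[OF j] by (simp add: abs_mult)
  qed
  have q_zero: "q \<Psi> (\<lambda>_. 0) j = 0" if "j \<in> J" for \<Psi> j
    using b(3)[OF that] by (simp add: q_def)
  have S_lim: "(q \<Psi> f \<longlongrightarrow> S \<Psi> f) U" if \<Psi>: "\<Psi> \<in> fst (Lip0 (c0 G))" and f: "f \<in> V" for \<Psi> f
  proof -
    have "\<forall>\<^sub>F j in U. \<bar>q \<Psi> f j\<bar> \<le> snd (Lip0 (c0 G)) \<Psi> * sup_dist f (\<lambda>_. 0)"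
      using UJ
    proof (rule eventually_mono)
      fix j assume "j \<in> J"
      then show "\<bar>q \<Psi> f j\<bar> \<le> snd (Lip0 (c0 G)) \<Psi> * sup_dist f (\<lambda>_. 0)"
        using q_lip[OF \<Psi> _ f fun_space_zero[OF V], of j] q_zero by simp
    qed
    then obtain l where "(q \<Psi> f \<longlongrightarrow> l) U" using Ulim by blast
    then show ?thesis using f U(1) tendsto_Lim[of U "q \<Psi> f" l] by (simp add: S_def)
  qed
  have S_lip: "\<bar>S \<Psi> f - S \<Psi> g\<bar> \<le> snd (Lip0 (c0 G)) \<Psi> * sup_dist f g"
    if \<Psi>: "\<Psi> \<in> fst (Lip0 (c0 G))" and fg: "f \<in> V" "g \<in> V" for \<Psi> f g
  proof (rule tendsto_upperbound)
    show "((\<lambda>j. \<bar>q \<Psi> f j - q \<Psi> g j\<bar>) \<longlongrightarrow> \<bar>S \<Psi> f - S \<Psi> g\<bar>) U"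
      by (intro tendsto_intros S_lim \<Psi> fg)
    show "\<forall>\<^sub>F j in U. \<bar>q \<Psi> f j - q \<Psi> g j\<bar> \<le> snd (Lip0 (c0 G)) \<Psi> * sup_dist f g"
      using UJ by (rule eventually_mono) (rule q_lip[OF \<Psi> _ fg])
  qed (use U in simp)
  have S_in: "S \<Psi> \<in> fst (Lip0 V)" if \<Psi>: "\<Psi> \<in> fst (Lip0 (c0 G))" for \<Psi>
  proof (rule Lip0_memI[OF _ _ S_lip[OF \<Psi>]])
    have "\<forall>\<^sub>F j in U. q \<Psi> (\<lambda>_. 0) j = 0"
      using UJ by (rule eventually_mono) (rule q_zero)
    then have "(q \<Psi> (\<lambda>_. 0) \<longlongrightarrow> 0) U" by (rule tendsto_eventually)
    with S_lim[OF \<Psi> fun_space_zero[OF V]] show "S \<Psi> (\<lambda>_. 0) = 0"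
      by (rule tendsto_unique[OF U(1)])
  qed (simp add: S_def)

  \<comment> \<open>The scales cancel and \<open>T \<Phi>\<close> vanishes at the centres, so the
    net is exactly \<open>\<Phi> (A j (b j f))\<close>; the Lipschitz bound of \<open>\<Phi>\<close>
    turns \<open>conv\<close> into convergence to \<open>\<Phi> f\<close>.\<close>
  have ST: "S (T \<Phi>) = \<Phi>" if \<Phi>: "\<Phi> \<in> fst (Lip0 V)" and T\<Phi>: "T \<Phi> \<in> fst (Lip0 (c0 G))" for \<Phi>
  proof
    fix f
    show "S (T \<Phi>) f = \<Phi> f"
    proof (cases "f \<in> V")
      case False
      then show ?thesis using Lip0_outside[OF \<Phi>] by (simp add: S_def)
    next
      case f: True
      have q_eq: "q (T \<Phi>) f j = \<Phi> (A j (b j f))" if j: "j \<in> J" for j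
      proof -
        have "b j f \<in> c0 G" using b(1)[OF j] f by blast
        then have "T \<Phi> (\<lambda>i. c j i + b j f i) = \<Phi> (A j (b j f)) / s j"
          using b(4)[OF j f] by (intro T_ball j)
        moreover have "T \<Phi> (c j) = 0"
          using T_ball[OF j fun_space_zero[OF fun_space_c0], of \<Phi>] A(3)[OF j] Lip0_zero[OF \<Phi>] by simp
        ultimately show ?thesis using s[OF j] by (simp add: q_def)
      qed
      have lim: "((\<lambda>j. snd (Lip0 V) \<Phi> * sup_dist (A j (b j f)) f) \<longlongrightarrow> 0) U"
        using tendsto_mono[OF U(2) conv[OF f]] by (rule tendsto_mult_right_zero)
      have "\<forall>\<^sub>F j in U. norm (q (T \<Phi>) f j - \<Phi> f) \<le> snd (Lip0 V) \<Phi> * sup_dist (A j (b j f)) f"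
        using UJ
      proof (rule eventually_mono)
        fix j assume j: "j \<in> J"
        have "A j (b j f) \<in> V" using A(1)[OF j] b(1)[OF j] f by blast
        then show "norm (q (T \<Phi>) f j - \<Phi> f) \<le> snd (Lip0 V) \<Phi> * sup_dist (A j (b j f)) f"
          using Lip0_lipschitz[OF V \<Phi> _ f] q_eq[OF j] by simp
      qed
      then have "((\<lambda>j. q (T \<Phi>) f j - \<Phi> f) \<longlongrightarrow> 0) U"
        using lim by (rule Lim_null_comparison)
      then have "(q (T \<Phi>) f \<longlongrightarrow> \<Phi> f) U" by (simp add: LIM_zero_iff)
      with S_lim[OF T\<Phi> f] show ?thesis by (rule tendsto_unique[OF U(1)])
    qed
  qed
  have T_in: "T \<Phi> \<in> fst (Lip0 (c0 G))" if "\<Phi> \<in> fst (Lip0 V)" for \<Phi>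
    by (rule Lip0_memI[OF T_zero _ T_lip[OF that]]) (simp add: T_def)

  \<comment> \<open>\<open>Lim\<close> is additive only where limits exist; \<open>S_lim\<close>
    provides them along the one filter \<open>U\<close> for all functions at once.\<close>
  have S_add: "S (\<lambda>x. \<Psi> x + \<Psi>' x) f = S \<Psi> f + S \<Psi>' f"
    if "\<Psi> \<in> fst (Lip0 (c0 G))" "\<Psi>' \<in> fst (Lip0 (c0 G))" for \<Psi> \<Psi>' f
  proof (cases "f \<in> V")
    case True
    have "q (\<lambda>x. \<Psi> x + \<Psi>' x) f = (\<lambda>j. q \<Psi> f j + q \<Psi>' f j)"
      by (auto simp: q_def algebra_simps)
    moreover have "((\<lambda>j. q \<Psi> f j + q \<Psi>' f j) \<longlongrightarrow> S \<Psi> f + S \<Psi>' f) U"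
      using that True by (intro tendsto_add S_lim)
    ultimately have "Lim U (q (\<lambda>x. \<Psi> x + \<Psi>' x) f) = S \<Psi> f + S \<Psi>' f"
      using tendsto_Lim[OF U(1)] by simp
    then show ?thesis using True by (simp add: S_def)
  qed (simp add: S_def)
  have S_scale: "S (\<lambda>x. r * \<Psi> x) f = r * S \<Psi> f" if "\<Psi> \<in> fst (Lip0 (c0 G))" for \<Psi> r f
  proof (cases "f \<in> V")
    case True
    have "q (\<lambda>x. r * \<Psi> x) f = (\<lambda>j. r * q \<Psi> f j)"
      by (auto simp: q_def algebra_simps)
    moreover have "((\<lambda>j. r * q \<Psi> f j) \<longlongrightarrow> r * S \<Psi> f) U"
      using that True by (intro tendsto_mult_left S_lim)
    ultimately have "Lim U (q (\<lambda>x. r * \<Psi> x) f) = r * S \<Psi> f"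
      using tendsto_Lim[OF U(1)] by simp
    then show ?thesis using True by (simp add: S_def)
  qed (simp add: S_def)

  show ?thesis
    unfolding factors_def
  proof (intro exI[of _ T] exI[of _ S] exI[of _ 6] conjI ballI)
    show "T ` fst (Lip0 V) \<subseteq> fst (Lip0 (c0 G))" using T_in by blast
    show "S ` fst (Lip0 (c0 G)) \<subseteq> fst (Lip0 V)" using S_in by blast
    show "lin_on (fst (Lip0 V)) T"
      by (auto simp: lin_on_def T_def u_def v_def fun_eq_iff sum_distrib_left add_divide_distrib
          algebra_simps simp flip: sum.distrib)
    show "lin_on (fst (Lip0 (c0 G))) S"
      using S_add S_scale by (auto simp: lin_on_def)
    show "snd (Lip0 (c0 G)) (T \<Phi>) \<le> 6 * snd (Lip0 V) \<Phi>" if "\<Phi> \<in> fst (Lip0 V)" for \<Phi>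
      using Lip0_norm_nonneg[OF V that] by (intro Lip0_norm_le T_lip that) auto
    show "snd (Lip0 V) (S \<Psi>) \<le> 6 * snd (Lip0 (c0 G)) \<Psi>" if "\<Psi> \<in> fst (Lip0 (c0 G))" for \<Psi>
    proof -
      have "0 \<le> snd (Lip0 (c0 G)) \<Psi>" by (rule Lip0_norm_nonneg[OF fun_space_c0 that])
      moreover have "snd (Lip0 V) (S \<Psi>) \<le> snd (Lip0 (c0 G)) \<Psi>"
        using calculation by (intro Lip0_norm_le S_lip that) auto
      ultimately show ?thesis by linarith
    qed
    show "S (T \<Phi>) = \<Phi>" if "\<Phi> \<in> fst (Lip0 V)" for \<Phi>
      using that by (intro ST T_in)
  qed simp
qed

subsection \<open>Zero-dimensional and finite compact spaces\<close>

definition clopens :: "'a topology \<Rightarrow> 'a set set" where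
  "clopens L = {V. openin L V \<and> closedin L V}"

text \<open>Two points belong to the same members iff they lie in the same atom of the finite algebra
  generated by the family.\<close>

definition membership :: "'a set set \<Rightarrow> 'a \<Rightarrow> 'a set set" where
  "membership \<A> t = {V\<in>\<A>. t \<in> V}"

lemma membership_subset: "membership \<A> t \<in> Pow \<A>"
  by (auto simp: membership_def)

text \<open>Each further clopen set cuts a class with itself or with its complement, and both are
  open.\<close>

lemma openin_membership_class:
  assumes "finite \<A>" "\<A> \<subseteq> clopens L"
  shows "openin L {s \<in> topspace L. membership \<A> s = membership \<A> t}"
  using assms
proof (induction \<A> rule: finite_induct)
  case empty
  then show ?case by (simp add: membership_def)
next
  case (insert V \<A>)
  have tr: "membership (insert V \<A>) r = (if r \<in> V then insert V (membership \<A> r) else membership \<A> r)"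
    "V \<notin> membership \<A> r" for r
    using insert.hyps(2) by (auto simp: membership_def)
  have "membership (insert V \<A>) s = membership (insert V \<A>) t \<longleftrightarrow> (s \<in> V \<longleftrightarrow> t \<in> V) \<and> membership \<A> s = membership \<A> t" for s
    using tr(2)[of s] tr(2)[of t] by (auto simp: tr(1) insert_ident)
  moreover have "V \<subseteq> topspace L" using insert.prems by (simp add: clopens_def openin_subset)
  ultimately have "{s \<in> topspace L. membership (insert V \<A>) s = membership (insert V \<A>) t} =
      {s \<in> topspace L. membership \<A> s = membership \<A> t} \<inter> (if t \<in> V then V else topspace L - V)"
    by auto
  moreover have "openin L (if t \<in> V then V else topspace L - V)"
    using insert.prems by (auto simp: clopens_def closedin_def)
  moreover have "openin L {s \<in> topspace L. membership \<A> s = membership \<A> t}" using insert by simp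
  ultimately show ?case by (simp only: openin_Int)
qed

text \<open>Locally constant functions are continuous, whatever values \<open>h\<close> assigns to
  the atoms.\<close>

lemma membership_step_in_CK:
  assumes "finite \<A>" "\<A> \<subseteq> clopens L"
  shows "(\<lambda>t. if t \<in> topspace L then h (membership \<A> t) else 0) \<in> CK L"
proof -
  have "\<exists>U. openin L U \<and> t \<in> U \<and> (\<forall>s\<in>U. \<bar>(if s \<in> topspace L then h (membership \<A> s) else 0)
      - (if t \<in> topspace L then h (membership \<A> t) else 0)\<bar> < e)"
    if "t \<in> topspace L" "0 < e" for t e
    by (rule exI[of _ "{s \<in> topspace L. membership \<A> s = membership \<A> t}"])
      (use that openin_membership_class[OF assms] in auto)
  then show ?thesis by (simp add: CK_def continuous_map_real_iff)
qed

text \<open>Compactness yields a finite cover by clopen base members on which \<open>f\<close>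
  oscillates by less than \<open>e\<close>; points with equal membership share a member of the
  cover.\<close>

lemma zero_dim_membership_approx:
  assumes L: "compact_space L" "zero_dim L" and f: "f \<in> CK L" and e: "0 < e"
  obtains \<A> where "finite \<A>" "\<A> \<subseteq> clopens L"
    "\<And>s t. s \<in> topspace L \<Longrightarrow> t \<in> topspace L \<Longrightarrow> membership \<A> s = membership \<A> t \<Longrightarrow> \<bar>f s - f t\<bar> < e"
proof -
  obtain B where B: "is_base L B" "\<forall>V\<in>B. closedin L V" using L(2) by (auto simp: zero_dim_def)
  define E where "E = {V\<in>B. \<forall>s\<in>V. \<forall>t\<in>V. \<bar>f s - f t\<bar> < e}"
  have "\<exists>V\<in>E. t \<in> V" if t: "t \<in> topspace L" for t
  proof -
    have "0 < e/2" using e by simp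
    then obtain U where U: "openin L U" "t \<in> U" "\<forall>s\<in>U. \<bar>f s - f t\<bar> < e/2"
      using f t unfolding CK_def continuous_map_real_iff by blast
    obtain V where V: "V \<in> B" "t \<in> V" "V \<subseteq> U" using is_base_nbhd[OF B(1) U(1,2)] .
    have "\<bar>f s - f s'\<bar> < e" if "s \<in> V" "s' \<in> V" for s s'
    proof -
      have "\<bar>f s - f t\<bar> < e/2" "\<bar>f s' - f t\<bar> < e/2" using U(3) V(3) that by auto
      then show ?thesis by linarith
    qed
    then show ?thesis using V by (auto simp: E_def)
  qed
  moreover have "\<forall>V\<in>E. openin L V" using B by (auto simp: E_def is_base_def)
  ultimately obtain \<A> where \<A>: "finite \<A>" "\<A> \<subseteq> E" "topspace L \<subseteq> \<Union>\<A>"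
    using L(1) unfolding compact_space_alt by (metis (no_types, lifting) UnionI subsetI)
  show thesis
  proof
    show "\<A> \<subseteq> clopens L" using \<A>(2) B by (auto simp: E_def clopens_def is_base_def)
    fix s t assume st: "s \<in> topspace L" "t \<in> topspace L" "membership \<A> s = membership \<A> t"
    obtain V where V: "V \<in> \<A>" "s \<in> V" using \<A>(3) st(1) by blast
    then have "t \<in> V" using st(3) by (auto simp: membership_def)
    then show "\<bar>f s - f t\<bar> < e" using V \<A>(2) by (auto simp: E_def)
  qed fact
qed

text \<open>Intersecting with the smaller family recovers its membership. Hence an approximation
  achieved by one family persists for all larger ones, as convergence along the net demands.\<close>

lemma membership_mono:
  assumes "\<A> \<subseteq> \<B>" "membership \<B> s = membership \<B> t"
  shows "membership \<A> s = membership \<A> t"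
proof -
  have "membership \<A> r = \<A> \<inter> membership \<B> r" for r
    using assms(1) by (auto simp: membership_def)
  then show ?thesis using assms(2) by simp
qed

definition unit_clamp :: "real \<Rightarrow> real" where
  "unit_clamp r = max (- 1) (min 1 r)"

lemma unit_clamp_lipschitz: "\<bar>unit_clamp r - unit_clamp r'\<bar> \<le> \<bar>r - r'\<bar>"
  and unit_clamp_bound: "\<bar>unit_clamp r\<bar> \<le> 1"
  and unit_clamp_id: "\<bar>r\<bar> \<le> 1 \<Longrightarrow> unit_clamp r = r"
  and unit_clamp_zero [simp]: "unit_clamp 0 = 0"
  by (auto simp: unit_clamp_def max_def min_def)

text \<open>The approximate factorizations sample a function at one point of each atom of a finite
  clopen algebra, scaled down and clamped to the unit ball.\<close>

theorem factors_CK_c0_zero_dim: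
  fixes L :: "'l topology" and G :: "'g set"
  assumes L: "compact_space L" "zero_dim L" and G: "infinite G" "clopens L \<lesssim> G"
  shows "factors (Lip0 (CK L)) (Lip0 (c0 G))"
proof -
  \<comment> \<open>An index is a finite clopen family with a scale: the family grows to gain
    accuracy, the scale so that clamping eventually changes nothing.\<close>
  define J where "J = Fpow (clopens L) \<times> (UNIV :: nat set)"
  define F where "F = finite_subsets_at_top (clopens L) \<times>\<^sub>F (sequentially :: nat filter)"
  have "J \<lesssim> G"
  proof -
    have "Fpow (clopens L) \<lesssim> Fpow G"
    proof -
      obtain h where h: "inj_on h (clopens L)" "h ` clopens L \<subseteq> G"
        using G(2) unfolding lepoll_def by blast
      have "inj_on (image h) (Fpow (clopens L))" using h(1) by (rule inj_on_image_Fpow)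
      moreover have "image h ` Fpow (clopens L) \<subseteq> Fpow G" using h(2) by (rule image_Fpow_mono)
      ultimately show ?thesis unfolding lepoll_def by blast
    qed
    also have "Fpow G \<lesssim> G" using G(1) by (rule infinite_Fpow_lepoll)
    finally have "Fpow (clopens L) \<lesssim> G" .
    moreover have "(UNIV :: nat set) \<lesssim> G" using G(1) by (simp add: infinite_le_lepoll)
    ultimately show ?thesis unfolding J_def by (rule infinite_times_lepoll[OF G(1)])
  qed
  then obtain e where e: "inj_on e J" "e ` J \<subseteq> G" unfolding lepoll_def by blast
  \<comment> \<open>The possible memberships are named by coordinates in \<open>G\<close>. Different
    families may reuse coordinates, since their copies are kept apart by the centres given by
    \<open>e\<close>.\<close>
  have "\<exists>\<iota>. inj_on \<iota> (Pow \<A>) \<and> \<iota> ` Pow \<A> \<subseteq> G" if "finite \<A>" for \<A> :: "'l set set"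
    using finite_lepoll_infinite[OF G(1), of "Pow \<A>"] that unfolding lepoll_def by simp
  then obtain \<iota> where \<iota>: "\<And>\<A> :: 'l set set. finite \<A> \<Longrightarrow> inj_on (\<iota> \<A>) (Pow \<A>)"
    "\<And>\<A> :: 'l set set. finite \<A> \<Longrightarrow> \<iota> \<A> ` Pow \<A> \<subseteq> G"
    by metis
  \<comment> \<open>\<open>SOME\<close> gives a point of the atom only for memberships that occur;
    \<open>b\<close> is supported on the coordinates of those.\<close>
  define pick where "pick \<A> \<sigma> = (SOME t. t \<in> topspace L \<and> membership \<A> t = \<sigma>)" for \<A> \<sigma>
  have pick: "pick \<A> (membership \<A> t) \<in> topspace L" "membership \<A> (pick \<A> (membership \<A> t)) = membership \<A> t"
    if "t \<in> topspace L" for \<A> t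
    using someI[of "\<lambda>s. s \<in> topspace L \<and> membership \<A> s = membership \<A> t" t] that by (auto simp: pick_def)
  \<comment> \<open>The \<open>+ 1\<close> keeps the scale positive at
    \<open>snd j = 0\<close>.\<close>
  define s where "s j = real (snd j) + 1" for j :: "'l set set \<times> nat"
  define A where "A j x = (\<lambda>t. if t \<in> topspace L then s j * x (\<iota> (fst j) (membership (fst j) t)) else 0)"
    for j and x :: "'g \<Rightarrow> real"
  define b where "b j f = (\<lambda>k. if k \<in> \<iota> (fst j) ` membership (fst j) ` topspace L
      then unit_clamp (f (pick (fst j) (inv_into (Pow (fst j)) (\<iota> (fst j)) k)) / s j) else 0)"
    for j and f :: "'l \<Rightarrow> real"
  have s_pos: "0 < s j" for j by (simp add: s_def)
  have J: "finite (fst j)" "fst j \<subseteq> clopens L" if "j \<in> J" for j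
    using that by (auto simp: J_def Fpow_def)
  note CK_bd = fun_space_bounded[OF fun_space_CK[OF L(1)]]
  note c0_bd = fun_space_bounded[OF fun_space_c0[of G]]
  have A_CK: "A j x \<in> CK L" if "j \<in> J" for j x
    unfolding A_def by (rule membership_step_in_CK[OF J[OF that]])
  have Ab: "A j (b j f) t = s j * unit_clamp (f (pick (fst j) (membership (fst j) t)) / s j)"
    if "j \<in> J" "t \<in> topspace L" for j f t
    using that \<iota>(1)[OF J(1)[OF that(1)]] membership_subset[of "fst j" t]
    by (simp add: A_def b_def inv_into_f_f)
  show ?thesis
  proof (rule factors_c0_of_approximate_factorizations[where F = F and J = J and e = e and s = s
        and A = A and b = b])
    show "F \<noteq> bot" by (simp add: F_def prod_filter_eq_bot)
    show "\<forall>\<^sub>F j in F. j \<in> J"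
    proof -
      have "\<forall>\<^sub>F \<A> in finite_subsets_at_top (clopens L). \<A> \<in> Fpow (clopens L)"
        by (rule eventually_finite_subsets_at_top_weakI) (simp add: Fpow_def)
      from eventually_prodI[OF this always_eventually[of "\<lambda>_. True" sequentially]]
      show ?thesis unfolding F_def J_def by (simp add: case_prod_unfold mem_Times_iff)
    qed
    show "A j ` c0 G \<subseteq> CK L" if "j \<in> J" for j
      using A_CK[OF that] by blast
    show "sup_lipschitz (s j) (c0 G) (A j)" for j
      unfolding sup_lipschitz_def
    proof (intro ballI sup_norm_least)
      fix x y t assume "x \<in> c0 G" "y \<in> c0 G"
      then have bd: "bounded_fun x" "bounded_fun y" using c0_bd by auto
      have "\<bar>A j x t - A j y t\<bar> \<le> s j * \<bar>x k - y k\<bar>" if "k = \<iota> (fst j) (membership (fst j) t)" for k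
        using s_pos[of j] that by (auto simp: A_def abs_mult simp flip: right_diff_distrib)
      also have "s j * \<bar>x k - y k\<bar> \<le> s j * sup_dist x y" for k
        using s_pos[of j] bd by (intro mult_left_mono sup_dist_upper) auto
      finally show "\<bar>A j x t - A j y t\<bar> \<le> s j * sup_dist x y" by simp
    qed
    show "A j (\<lambda>_. 0) = (\<lambda>_. 0)" for j by (auto simp: A_def)
    show "b j ` CK L \<subseteq> c0 G" if j: "j \<in> J" for j
    proof -
      have "\<iota> (fst j) ` membership (fst j) ` topspace L \<subseteq> \<iota> (fst j) ` Pow (fst j)"
        by (intro image_mono) (simp add: image_subset_iff membership_subset del: Pow_iff)
      moreover have "finite (\<iota> (fst j) ` Pow (fst j))" using J(1)[OF j] by simp
      ultimately have "b j f \<in> c0 G" for f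
        using \<iota>(2)[OF J(1)[OF j]]
        by (intro c0_finite_support[of "\<iota> (fst j) ` Pow (fst j)"]) (auto simp: b_def)
      then show ?thesis by blast
    qed
    show "sup_lipschitz (1 / s j) (CK L) (b j)" for j
      unfolding sup_lipschitz_def
    proof (intro ballI sup_norm_least)
      fix f g k assume "f \<in> CK L" "g \<in> CK L"
      then have bd: "bounded_fun f" "bounded_fun g" using CK_bd by auto
      define t where "t = pick (fst j) (inv_into (Pow (fst j)) (\<iota> (fst j)) k)"
      have "\<bar>b j f k - b j g k\<bar> \<le> \<bar>f t / s j - g t / s j\<bar>"
        using unit_clamp_lipschitz by (simp add: b_def t_def)
      also have "\<dots> = 1 / s j * \<bar>f t - g t\<bar>"
        using s_pos[of j] by (simp add: abs_divide flip: diff_divide_distrib)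
      also have "\<dots> \<le> 1 / s j * sup_dist f g"
        using s_pos[of j] bd by (intro mult_left_mono sup_dist_upper) auto
      finally show "\<bar>b j f k - b j g k\<bar> \<le> 1 / s j * sup_dist f g" .
    qed
    show "b j (\<lambda>_. 0) = (\<lambda>_. 0)" for j by (auto simp: b_def)
    show "sup_norm (b j f) \<le> 1" for j f
      by (rule sup_norm_least) (simp add: b_def unit_clamp_bound)
    \<comment> \<open>Once the scale exceeds the norm of \<open>f\<close>, the clamp is the identity
      and \<open>A j (b j f) t\<close> is the value of \<open>f\<close> at a sample point in the
      atom of \<open>t\<close>; refining a good family makes it close to \<open>f t\<close>.\<close>
    show "((\<lambda>j. sup_dist (A j (b j f)) f) \<longlongrightarrow> 0) F" if f: "f \<in> CK L" for f
    proof (rule tendstoI)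
      fix \<epsilon> :: real assume \<epsilon>: "0 < \<epsilon>"
      then have "0 < \<epsilon>/2" by simp
      from zero_dim_membership_approx[OF L f this] obtain \<A>\<^sub>0 where \<A>\<^sub>0: "finite \<A>\<^sub>0" "\<A>\<^sub>0 \<subseteq> clopens L"
        "\<And>s t. s \<in> topspace L \<Longrightarrow> t \<in> topspace L \<Longrightarrow> membership \<A>\<^sub>0 s = membership \<A>\<^sub>0 t \<Longrightarrow> \<bar>f s - f t\<bar> < \<epsilon>/2"
        by blast
      have "\<forall>\<^sub>F \<A> in finite_subsets_at_top (clopens L). finite \<A> \<and> \<A>\<^sub>0 \<subseteq> \<A> \<and> \<A> \<subseteq> clopens L"
        using \<A>\<^sub>0(1,2) unfolding eventually_finite_subsets_at_top by blast
      from eventually_prodI[OF this eventually_ge_at_top[of "nat \<lceil>sup_norm f\<rceil>"]]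
      show "\<forall>\<^sub>F j in F. dist (sup_dist (A j (b j f)) f) 0 < \<epsilon>"
        unfolding F_def[symmetric]
      proof (rule eventually_mono)
        fix j :: "'l set set \<times> nat"
        assume "(finite (fst j) \<and> \<A>\<^sub>0 \<subseteq> fst j \<and> fst j \<subseteq> clopens L) \<and> nat \<lceil>sup_norm f\<rceil> \<le> snd j"
        then have j: "j \<in> J" "\<A>\<^sub>0 \<subseteq> fst j" and n: "sup_norm f \<le> s j"
          by (auto simp: J_def Fpow_def mem_Times_iff s_def nat_le_iff ceiling_le_iff)
        have "\<bar>A j (b j f) t - f t\<bar> \<le> \<epsilon>/2" for t
        proof (cases "t \<in> topspace L")
          case t: True
          define r where "r = pick (fst j) (membership (fst j) t)"
          have r: "r \<in> topspace L" "membership (fst j) r = membership (fst j) t"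
            using pick[OF t] by (auto simp: r_def)
          have "\<bar>f r\<bar> \<le> s j" using sup_norm_upper[OF CK_bd[OF f], of r] n by linarith
          then have "\<bar>f r / s j\<bar> \<le> 1" using s_pos[of j] by (simp add: abs_divide)
          then have "A j (b j f) t = f r"
            using Ab[OF j(1) t] s_pos[of j] by (simp add: unit_clamp_id r_def)
          moreover have "\<bar>f r - f t\<bar> < \<epsilon>/2"
            using membership_mono[OF j(2) r(2)] by (intro \<A>\<^sub>0(3) r t)
          ultimately show ?thesis by simp
        next
          case False
          then show ?thesis using f \<epsilon> by (simp add: A_def CK_def)
        qed
        then have "sup_dist (A j (b j f)) f \<le> \<epsilon>/2" by (rule sup_norm_least)
        moreover have "0 \<le> sup_dist (A j (b j f)) f"
          using CK_bd[OF A_CK[OF j(1)]] CK_bd[OF f] by (simp add: sup_norm_nonneg)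
        ultimately show "dist (sup_dist (A j (b j f)) f) 0 < \<epsilon>" using \<epsilon> by simp
      qed
    qed
  qed (simp_all add: e s_pos fun_space_CK[OF L(1)])
qed

section \<open>Finite compact spaces\<close>

text \<open>The members of the base containing a point determine it, so the space is finite and
  discrete. Its open singletons must lie in the base, which bounds the number of points by
  \<open>G\<close>, and the points then serve as coordinates.\<close>

lemma factors_CK_c0_finite:
  assumes K: "compact_space K" "Hausdorff_space K" and B: "is_base K B" "finite B" and G: "B \<lesssim> G"
  shows "factors (Lip0 (CK K)) (Lip0 (c0 G))"
proof -
  have "inj_on (\<lambda>t. {V\<in>B. t \<in> V}) (topspace K)"
  proof (rule inj_onI, rule ccontr)
    fix s t assume st: "s \<in> topspace K" "t \<in> topspace K" "{V\<in>B. s \<in> V} = {V\<in>B. t \<in> V}" "s \<noteq> t"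
    then obtain U where U: "openin K U" "s \<in> U" "t \<notin> U"
      using Hausdorff_imp_t1_space[OF K(2)] unfolding t1_space_def by blast
    obtain V where "V \<in> B" "s \<in> V" "V \<subseteq> U" using is_base_nbhd[OF B(1) U(1,2)] .
    then show False using st(3) U(3) by blast
  qed
  moreover have "finite ((\<lambda>t. {V\<in>B. t \<in> V}) ` topspace K)"
    by (rule finite_subset[of _ "Pow B"]) (use B(2) in auto)
  ultimately have fin: "finite (topspace K)" using finite_imageD by blast
  have disc: "K = discrete_topology (topspace K)"
    using fin Hausdorff_imp_t1_space[OF K(2)] finite_t1_space_imp_discrete_topology by blast
  have "(\<lambda>t. {t}) ` topspace K \<subseteq> B"
  proof
    fix W assume "W \<in> (\<lambda>t. {t}) ` topspace K"
    then obtain t where t: "t \<in> topspace K" "W = {t}" by blast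
    have "openin K {t}" using t(1) by (subst disc) (simp add: openin_discrete_topology)
    from is_base_nbhd[OF B(1) this, of t] obtain V where "V \<in> B" "t \<in> V" "V \<subseteq> {t}" by blast
    then show "W \<in> B" using t(2) by (metis empty_iff subset_singletonD)
  qed
  then have "(\<lambda>t. {t}) ` topspace K \<lesssim> G" using G by (meson lepoll_trans subset_imp_lepoll)
  then have "topspace K \<lesssim> G" by (simp add: inj_on_def)
  then obtain \<iota> where \<iota>: "inj_on \<iota> (topspace K)" "\<iota> ` topspace K \<subseteq> G" unfolding lepoll_def by blast
  define i where "i f = (\<lambda>k. if k \<in> \<iota> ` topspace K then f (inv_into (topspace K) \<iota> k) else 0)"
    for f :: "'a \<Rightarrow> real"
  define r where "r x = (\<lambda>t. if t \<in> topspace K then x (\<iota> t) else 0)" for x :: "'b \<Rightarrow> real"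
  note CK_bd = fun_space_bounded[OF fun_space_CK[OF K(1)]]
  note c0_bd = fun_space_bounded[OF fun_space_c0[of G]]
  show ?thesis
  proof (rule factors_lipschitz_retract[where i = i and r = r and c = 1])
    show "i ` CK K \<subseteq> c0 G"
      using fin \<iota>(2) by (auto intro!: c0_finite_support[of "\<iota> ` topspace K"] simp: i_def)
    show "sup_lipschitz 1 (CK K) i"
      unfolding sup_lipschitz_def
      by (auto intro!: sup_norm_least simp: i_def sup_dist_upper sup_norm_nonneg CK_bd)
    show "r ` c0 G \<subseteq> CK K"
    proof -
      have "continuous_map K euclideanreal (r x)" for x
        by (subst disc) simp
      then show ?thesis by (auto simp: CK_def r_def)
    qed
    show "sup_lipschitz 1 (c0 G) r"
      unfolding sup_lipschitz_def
      by (auto intro!: sup_norm_least simp: r_def sup_dist_upper sup_norm_nonneg c0_bd)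
    show "r (i f) = f" if "f \<in> CK K" for f
      using that \<iota>(1) by (auto simp: r_def i_def CK_def)
  qed (simp_all add: i_def r_def fun_space_c0 fun_space_CK K(1) cong: if_cong)
qed

section \<open>Isomorphisms of C(K) and the number of clopen sets\<close>

lemma CK_diff:
  "f \<in> CK K \<Longrightarrow> g \<in> CK K \<Longrightarrow> (\<lambda>t. f t - g t) \<in> CK K"
  by (simp add: CK_def continuous_map_diff)

lemma CK_scale: "f \<in> CK K \<Longrightarrow> (\<lambda>t. c * f t) \<in> CK K"
  by (simp add: CK_def continuous_map_real_mult)

text \<open>By linearity the norm bounds apply to differences: the upper one makes \<open>T\<close>
  Lipschitz, the lower one its inverse. This is the form that
  \<open>factors_lipschitz_retract\<close> takes.\<close>

lemma banach_iso_CK_lipschitz: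
  assumes K: "compact_space K" and L: "compact_space L" and iso: "banach_iso (CK_space K) (CK_space L)"
  obtains T S D where "0 < D" "T ` CK K \<subseteq> CK L" "S ` CK L \<subseteq> CK K"
    "sup_lipschitz D (CK K) T" "sup_lipschitz D (CK L) S"
    "T (\<lambda>_. 0) = (\<lambda>_. 0)" "S (\<lambda>_. 0) = (\<lambda>_. 0)"
    "\<And>f. f \<in> CK K \<Longrightarrow> S (T f) = f" "\<And>g. g \<in> CK L \<Longrightarrow> T (S g) = g"
proof -
  obtain T C where T: "bij_betw T (CK K) (CK L)" "lin_on (CK K) T"
    and bnd: "\<And>f. f \<in> CK K \<Longrightarrow> sup_norm (T f) \<le> C * sup_norm f \<and> sup_norm f \<le> C * sup_norm (T f)"
    using iso unfolding CK_space_eq banach_iso_def by auto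
  define S where "S = inv_into (CK K) T"
  \<comment> \<open>\<open>banach_iso\<close> leaves the sign of \<open>C\<close> open;
    \<open>D\<close> is positive and at least \<open>C\<close>.\<close>
  define D where "D = \<bar>C\<bar> + 1"
  note K_bd = fun_space_bounded[OF fun_space_CK[OF K]]
  note L_bd = fun_space_bounded[OF fun_space_CK[OF L]]
  have TS: "T (S g) = g" "S g \<in> CK K" if "g \<in> CK L" for g
    using that T(1) by (auto simp: S_def bij_betw_def f_inv_into_f inv_into_into)
  have ST: "S (T f) = f" "T f \<in> CK L" if "f \<in> CK K" for f
    using that T(1) by (auto simp: S_def bij_betw_def)
  have T_diff: "T (\<lambda>t. f t - g t) = (\<lambda>t. T f t - T g t)" if "f \<in> CK K" "g \<in> CK K" for f g
  proof -
    have "T (\<lambda>t. f t + (-1) * g t) = (\<lambda>t. T f t + T (\<lambda>t. (-1) * g t) t)"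
      using T(2)[unfolded lin_on_def, THEN conjunct1, rule_format, OF that(1) CK_scale[OF that(2), of "-1"]] .
    also have "T (\<lambda>t. (-1) * g t) = (\<lambda>t. (-1) * T g t)"
      using T(2)[unfolded lin_on_def, THEN conjunct2, rule_format, OF that(2), of "-1"] .
    finally show ?thesis by simp
  qed
  have T_zero: "T (\<lambda>_. 0) = (\<lambda>_. 0)"
    using T_diff[OF fun_space_zero[OF fun_space_CK[OF K]] fun_space_zero[OF fun_space_CK[OF K]]] by simp
  have C_D: "C * r \<le> D * r" if "0 \<le> r" for r
    using that by (intro mult_right_mono) (auto simp: D_def)
  have T_bnd: "sup_dist (T f) (T g) \<le> D * sup_dist f g" "sup_dist f g \<le> D * sup_dist (T f) (T g)"
    if "f \<in> CK K" "g \<in> CK K" for f g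
  proof -
    have "sup_dist (T f) (T g) \<le> C * sup_dist f g" "sup_dist f g \<le> C * sup_dist (T f) (T g)"
      using bnd[OF CK_diff[OF that]] by (simp_all add: T_diff[OF that])
    moreover have "0 \<le> sup_dist f g" "0 \<le> sup_dist (T f) (T g)"
      using that ST(2) by (simp_all add: sup_norm_nonneg K_bd L_bd)
    ultimately show "sup_dist (T f) (T g) \<le> D * sup_dist f g" "sup_dist f g \<le> D * sup_dist (T f) (T g)"
      using C_D order_trans by blast+
  qed
  show thesis
  proof (rule that[of D T S])
    show "0 < D" by (simp add: D_def)
    show "sup_lipschitz D (CK K) T" using T_bnd(1) by (simp add: sup_lipschitz_def)
    show "sup_lipschitz D (CK L) S"
      using T_bnd(2)[OF TS(2) TS(2)] by (simp add: sup_lipschitz_def TS(1))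
    show "S (\<lambda>_. 0) = (\<lambda>_. 0)"
      using ST(1)[OF fun_space_zero[OF fun_space_CK[OF K]]] by (simp add: T_zero)
  qed (use TS ST T_zero in auto)
qed

text \<open>Indicators of distinct clopen sets are at distance at least 1, and \<open>S\<close>
  shrinks distances by at most the factor \<open>d\<close>, so their images form a family in C(K)
  separated by \<open>1 / d\<close>.\<close>

lemma clopens_lepoll_base:
  assumes K: "compact_space K" and L: "compact_space L" and B: "is_base K B" "infinite B"
    and S: "S ` CK L \<subseteq> CK K" and d: "0 < d"
    and lower: "\<And>f g. f \<in> CK L \<Longrightarrow> g \<in> CK L \<Longrightarrow> sup_dist f g \<le> d * sup_dist (S f) (S g)"
  shows "clopens L \<lesssim> B"
proof -
  define ind :: "'b set \<Rightarrow> 'b \<Rightarrow> real" where "ind V = (\<lambda>t. if t \<in> V then 1 else 0)" for V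
  have ind_CK: "ind V \<in> CK L" if "V \<in> clopens L" for V
  proof -
    have "(\<lambda>t. if t \<in> topspace L then (if membership {V} t = {} then 0 else 1) else 0) \<in> CK L"
      using that by (intro membership_step_in_CK) auto
    moreover have "(\<lambda>t. if t \<in> topspace L then (if membership {V} t = {} then 0 else 1) else 0) = ind V"
      using that openin_subset by (auto simp: ind_def membership_def clopens_def fun_eq_iff)
    ultimately show ?thesis by simp
  qed
  have sep: "1 / d \<le> sup_dist (S (ind V)) (S (ind W))"
    if VW: "V \<in> clopens L" "W \<in> clopens L" "V \<noteq> W" for V W
  proof -
    obtain t where "t \<in> V \<longleftrightarrow> t \<notin> W" using VW(3) by blast
    then have "1 \<le> \<bar>ind V t - ind W t\<bar>" by (auto simp: ind_def)
    also have "\<dots> \<le> sup_dist (ind V) (ind W)"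
      using VW ind_CK by (intro sup_dist_upper fun_space_bounded[OF fun_space_CK[OF L]])
    also have "\<dots> \<le> d * sup_dist (S (ind V)) (S (ind W))" using VW ind_CK by (intro lower)
    finally show ?thesis using d by (simp add: pos_divide_le_eq mult.commute)
  qed
  have inj: "inj_on (\<lambda>V. S (ind V)) (clopens L)"
  proof (rule inj_onI, rule ccontr)
    fix V W assume "V \<in> clopens L" "W \<in> clopens L" "S (ind V) = S (ind W)" "V \<noteq> W"
    then have "1 / d \<le> 0" using sep[of V W] by simp
    then show False using d by simp
  qed
  have "(\<lambda>V. S (ind V)) ` clopens L \<lesssim> B"
  proof (rule separated_lepoll_base[OF K B])
    show "0 < 1 / d" using d by simp
    show "(\<lambda>V. S (ind V)) ` clopens L \<subseteq> CK K" using S ind_CK by auto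
    show "1 / d \<le> sup_dist f g"
      if "f \<in> (\<lambda>V. S (ind V)) ` clopens L" "g \<in> (\<lambda>V. S (ind V)) ` clopens L" "f \<noteq> g" for f g
      using that sep by blast
  qed
  then show ?thesis using inj by simp
qed

theorem mainTheorem2:
  fixes K :: "'a topology" and U :: "'a set set" and Gamma :: "'g set" and Kappa :: "'k set"
  assumes "compact_space K" and "Hausdorff_space K"
    and "\<exists>L :: 'l topology. compact_space L \<and> Hausdorff_space L \<and> zero_dim L \<and>
           banach_iso (CK_space K) (CK_space L)"
    and "has_weight K Kappa"
    and "cellular K U" and "U \<approx> Gamma"
  shows "compl_embeds (Lip0_space (c0_space Gamma)) (Lip0_space (CK_space K)) \<and>
         compl_embeds (Lip0_space (CK_space K)) (Lip0_space (c0_space Kappa))"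
proof -
  obtain L :: "'l topology" where L: "compact_space L" "zero_dim L"
      "banach_iso (CK_space K) (CK_space L)"
    using assms(3) by blast
  obtain B where B: "is_base K B" "B \<approx> Kappa" using assms(4) by (auto simp: has_weight_def)
  have "factors (Lip0 (CK K)) (Lip0 (c0 Kappa))"
  \<comment> \<open>Absorbing finite families and rational values needs an infinite base; a finite
    one forces a finite discrete space.\<close>
  proof (cases "finite B")
    case True
    then show ?thesis
      using assms(1,2) B by (intro factors_CK_c0_finite eqpoll_imp_lepoll)
  next
    case False
    \<comment> \<open>The isomorphism serves twice: it counts the clopen sets of \<open>L\<close> by
      the base of \<open>K\<close>, and it carries the factorization from \<open>CK L\<close> over
      to \<open>CK K\<close>.\<close>
    obtain T S D where TS: "0 < D" "T ` CK K \<subseteq> CK L" "S ` CK L \<subseteq> CK K"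
      "sup_lipschitz D (CK K) T" "sup_lipschitz D (CK L) S"
      "T (\<lambda>_. 0) = (\<lambda>_. 0)" "S (\<lambda>_. 0) = (\<lambda>_. 0)"
      "\<And>f. f \<in> CK K \<Longrightarrow> S (T f) = f" "\<And>g. g \<in> CK L \<Longrightarrow> T (S g) = g"
      by (rule banach_iso_CK_lipschitz[OF assms(1) L(1,3)], rule that)
    have "clopens L \<lesssim> B"
    proof (rule clopens_lepoll_base[OF assms(1) L(1) B(1) False TS(3,1)])
      fix f g assume fg: "f \<in> CK L" "g \<in> CK L"
      then have "sup_dist (T (S f)) (T (S g)) \<le> D * sup_dist (S f) (S g)"
        using TS(3,4) unfolding sup_lipschitz_def by blast
      then show "sup_dist f g \<le> D * sup_dist (S f) (S g)" using TS(9) fg by simp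
    qed
    then have "clopens L \<lesssim> Kappa" "infinite Kappa"
      using B(2) False by (auto intro: lepoll_trans2 simp: eqpoll_finite_iff)
    then have "factors (Lip0 (CK L)) (Lip0 (c0 Kappa))"
      by (intro factors_CK_c0_zero_dim L)
    moreover have "factors (Lip0 (CK K)) (Lip0 (CK L))"
      using TS assms(1) L(1)
      by (intro factors_lipschitz_retract[where i = T and r = S and c = D] fun_space_CK) auto
    ultimately show ?thesis by (rule factors_trans[rotated])
  qed
  moreover have "factors (Lip0 (c0 Gamma)) (Lip0 (CK K))"
    by (rule factors_c0_CK_of_cellular) fact+
  ultimately show ?thesis
    unfolding c0_space_eq CK_space_eq
    by (intro conjI compl_embeds_Lip0 fun_space_c0 fun_space_CK assms(1))
qed

end
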